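(* If $X$ and $Y$ are factored chain complexes over a field $\mathbb{F}$, then $$d_I(X,Y)=\max_{n\in\mathbb{N}} d_B(\mathrm{tBar}_n(X),\mathrm{tBar}_n(Y)),$$ where $d_I$ is the interleaving distance, $d_B$ is the bottleneck distance between multisets of tagged intervals, and $\mathrm{tBar}_n$ denotes the tagged barcode in degree $n$.
   Context: $\mathbb{N}=\{0,1,2,\dots\}$. Fix a field $\mathbb{F}$. $\mathrm{Ch}$ is the category of non-negative ($C_i=0$ for $i<0$), compact (every $C_i$ finite-dimensional, all but finitely many zero) chain complexes over $\mathbb{F}$. A parametrized chain complex is a functor $X\colon[0,\infty)\to\mathrm{Ch}$ from the poset category, with values $X^t$ and internal maps $X^{s\le t}$; morphisms are natural transformations. $X$ is tame if for every $t$ there is $\varepsilon>0$ such that $X^{t\le t+\delta}$ is an isomorphism for all $0\le\delta\le\varepsilon$, and for all but finitely many $t>0$ there is $\varepsilon>0$ such that $X^{t-\delta\le t}$ is an isomorphism for all $0\le\delta\le\varepsilon$. $X$ is epimorphic if all internal maps are epimorphisms. A factored chain complex is a tame epimorphic parametrized chain complex. For $n\ge1$, $D^n\in\mathrm{Ch}$ has $\mathbb{F}$ in degrees $n,n-1$ with $\partial_n=\mathrm{id}$; for $n\ge 0$, $S^n$ has $\mathbb{F}$ in degree $n$ only; $\Psi^n\colon D^n\to S^n$ is the identity in degree $n$ and zero elsewhere. A tagged interval $[0,s,t)$ consists of $0<t\le\infty$ and $s\in[0,t]$. The interval functor $\mathcal{I}^n[0,s,t)$ (with $s=0$ if $n=0$)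 takes value $D^n$ at $r$ with $0\le r<s$, $S^n$ at $r$ with $s\le r<t$, and $0$ for $r\ge t$, with internal maps $\mathrm{id}_{D^n}$, $\Psi^n$ (from $q<s$ to $s\le r<t$), $\mathrm{id}_{S^n}$, or $0$ accordingly. Every factored chain complex $X$ is isomorphic to $\bigoplus_{n}\bigoplus_{[0,s,t)\in\mathrm{tBar}_n(X)}\mathcal{I}^n[0,s,t)$ for unique finite multisets $\mathrm{tBar}_n(X)$ of tagged intervals; $\mathrm{tBar}_n(X)$ is the tagged barcode of $X$ in degree $n$. Interleaving distance: for $\varepsilon>0$, the shift $X_\varepsilon$ is given by $(X_\varepsilon)^t=X^{t+\varepsilon}$, $(X_\varepsilon)^{s\le t}=X^{s+\varepsilon\le t+\varepsilon}$, and $(\phi_\varepsilon)^t=\phi^{t+\varepsilon}$ for morphisms. An $\varepsilon$-interleaving of $X,Y$ is a pair of morphisms $\phi\colon X\to Y_\varepsilon$, $\psi\colon Y\to X_\varepsilon$ with $(\psi_\varepsilon\circ\phi)^t=X^{t\le t+2\varepsilon}$ and $(\phi_\varepsilon\circ\psi)^t=Y^{t\le t+2\varepsilon}$ for all $t\ge0$. $d_I(X,Y)=\inf\{\varepsilon>0\mid \text{there is an }\varepsilon\text{-interleaving}\}$, with $\inf\emptyset=\infty$. Bottleneck distance: for tagged intervals $J=[0,s,t)$, $J'=[0,s',t')$ let $c(J,J')=\max\{|s-s'|,|t-t'|\}$ (with $|\infty-\infty|=0$) and $W(J)=t/2$. Multisets are identified with their representations (elements counted with multiplicity). A matching between multisets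 $\mathcal{A},\mathcal{B}$ is a subset $\mathcal{M}\subseteq\mathcal{A}\times\mathcal{B}$ in which each element of $\mathcal{A}$ and each element of $\mathcal{B}$ occurs at most once; elements not occurring are unmatched. Its cost is $\max\{\sup_{(I,J)\in\mathcal{M}}c(I,J),\ \sup_{I\in\mathcal{A}\cup\mathcal{B}\text{ unmatched}}W(I)\}$, and $d_B(\mathcal{A},\mathcal{B})$ is the infimum of the costs of all matchings. *)

theory Defs
  imports
    Complex_Main
    "HOL-Library.Multiset"
    "HOL-Library.Extended_Nonnegative_Real"
    "HOL-Library.Function_Algebras"
begin

section \<open>Chain complexes\<close>

text \<open>
  The field is the type variable \<open>'f::field\<close>. A vector space over it is a subspace of an
  ambient vector space, given by a type \<open>'a::ab_group_add\<close> and a scalar multiplication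
  \<open>sc :: 'f \<Rightarrow> 'a \<Rightarrow> 'a\<close> with \<open>vector_space sc\<close>. As \<open>'a\<close> and \<open>sc\<close> are arbitrary, this is no
  restriction: any family of vector spaces embeds in its direct sum. Maps are total HOL functions
  whose values matter on the carriers only, so all identities between maps are required on the
  carriers only.
\<close>

definition lin_map ::
  "('f::field \<Rightarrow> 'a::ab_group_add \<Rightarrow> 'a) \<Rightarrow> ('f \<Rightarrow> 'b::ab_group_add \<Rightarrow> 'b) \<Rightarrow>
    'a set \<Rightarrow> 'b set \<Rightarrow> ('a \<Rightarrow> 'b) \<Rightarrow> bool" where
  "lin_map sc sc' V W f \<longleftrightarrow>
    (\<forall>x\<in>V. f x \<in> W) \<and>
    (\<forall>x\<in>V. \<forall>y\<in>V. f (x + y) = f x + f y) \<and>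
    (\<forall>c. \<forall>x\<in>V. f (sc c x) = sc' c (f x))"

text \<open>
  Complexes vanish in negative degrees, so degrees are natural numbers. \<open>bd C n\<close> is the
  differential from degree \<open>n\<close> to degree \<open>n - 1\<close>; the differential out of degree 0 is zero and
  \<open>bd C 0\<close> is never used.
\<close>

record 'a cplx =
  ob :: "nat \<Rightarrow> 'a set"
  bd :: "nat \<Rightarrow> 'a \<Rightarrow> 'a"

definition chain_complex ::
  "('f::field \<Rightarrow> 'a::ab_group_add \<Rightarrow> 'a) \<Rightarrow> 'a cplx \<Rightarrow> bool" where
  "chain_complex sc C \<longleftrightarrow>
    (\<forall>i. module.subspace sc (ob C i)) \<and>
    (\<forall>i. lin_map sc sc (ob C (Suc i)) (ob C i) (bd C (Suc i))) \<and>
    (\<forall>i. \<forall>x\<in>ob C (Suc (Suc i)). bd C (Suc i) (bd C (Suc (Suc i)) x) = 0)"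

definition compact_complex ::
  "('f::field \<Rightarrow> 'a::ab_group_add \<Rightarrow> 'a) \<Rightarrow> 'a cplx \<Rightarrow> bool" where
  "compact_complex sc C \<longleftrightarrow>
    (\<forall>i. \<exists>B. finite B \<and> module.span sc B = ob C i) \<and> finite {i. ob C i \<noteq> {0}}"

text \<open>The objects of the category \<open>Ch\<close>.\<close>

definition ch_obj ::
  "('f::field \<Rightarrow> 'a::ab_group_add \<Rightarrow> 'a) \<Rightarrow> 'a cplx \<Rightarrow> bool" where
  "ch_obj sc C \<longleftrightarrow> chain_complex sc C \<and> compact_complex sc C"

definition ch_map ::
  "('f::field \<Rightarrow> 'a::ab_group_add \<Rightarrow> 'a) \<Rightarrow> ('f \<Rightarrow> 'b::ab_group_add \<Rightarrow> 'b) \<Rightarrow>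
    'a cplx \<Rightarrow> 'b cplx \<Rightarrow> (nat \<Rightarrow> 'a \<Rightarrow> 'b) \<Rightarrow> bool" where
  "ch_map sc sc' C D f \<longleftrightarrow>
    (\<forall>i. lin_map sc sc' (ob C i) (ob D i) (f i)) \<and>
    (\<forall>i. \<forall>x\<in>ob C (Suc i). f i (bd C (Suc i) x) = bd D (Suc i) (f (Suc i) x))"

definition ch_iso ::
  "('f::field \<Rightarrow> 'a::ab_group_add \<Rightarrow> 'a) \<Rightarrow> ('f \<Rightarrow> 'b::ab_group_add \<Rightarrow> 'b) \<Rightarrow>
    'a cplx \<Rightarrow> 'b cplx \<Rightarrow> (nat \<Rightarrow> 'a \<Rightarrow> 'b) \<Rightarrow> bool" where
  "ch_iso sc sc' C D f \<longleftrightarrow>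
    ch_map sc sc' C D f \<and>
    (\<exists>g. ch_map sc' sc D C g \<and>
      (\<forall>i. \<forall>x\<in>ob C i. g i (f i x) = x) \<and> (\<forall>i. \<forall>y\<in>ob D i. f i (g i y) = y))"

text \<open>Epimorphisms of chain complexes are the degreewise surjective chain maps.\<close>

definition ch_epi ::
  "('f::field \<Rightarrow> 'a::ab_group_add \<Rightarrow> 'a) \<Rightarrow> ('f \<Rightarrow> 'b::ab_group_add \<Rightarrow> 'b) \<Rightarrow>
    'a cplx \<Rightarrow> 'b cplx \<Rightarrow> (nat \<Rightarrow> 'a \<Rightarrow> 'b) \<Rightarrow> bool" where
  "ch_epi sc sc' C D f \<longleftrightarrow>
    ch_map sc sc' C D f \<and> (\<forall>i. f i ` ob C i = ob D i)"

section \<open>Parametrized chain complexes\<close>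

text \<open>
  \<open>val X t\<close> is the value at \<open>t\<close>, and \<open>tr X s t\<close> is the internal map from \<open>val X s\<close> to
  \<open>val X t\<close>. Only parameters \<open>0 \<le> s \<le> t\<close> matter.
\<close>

record 'a pcplx =
  val :: "real \<Rightarrow> 'a cplx"
  tr :: "real \<Rightarrow> real \<Rightarrow> nat \<Rightarrow> 'a \<Rightarrow> 'a"

definition parametrized_complex ::
  "('f::field \<Rightarrow> 'a::ab_group_add \<Rightarrow> 'a) \<Rightarrow> 'a pcplx \<Rightarrow> bool" where
  "parametrized_complex sc X \<longleftrightarrow>
    (\<forall>t\<ge>0. ch_obj sc (val X t)) \<and>
    (\<forall>s t. 0 \<le> s \<longrightarrow> s \<le> t \<longrightarrow> ch_map sc sc (val X s) (val X t) (tr X s t)) \<and>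
    (\<forall>t\<ge>0. \<forall>i. \<forall>x\<in>ob (val X t) i. tr X t t i x = x) \<and>
    (\<forall>r s t. 0 \<le> r \<longrightarrow> r \<le> s \<longrightarrow> s \<le> t \<longrightarrow>
      (\<forall>i. \<forall>x\<in>ob (val X r) i. tr X s t i (tr X r s i x) = tr X r t i x))"

definition tame ::
  "('f::field \<Rightarrow> 'a::ab_group_add \<Rightarrow> 'a) \<Rightarrow> 'a pcplx \<Rightarrow> bool" where
  "tame sc X \<longleftrightarrow>
    (\<forall>t\<ge>0. \<exists>\<epsilon>>0. \<forall>\<delta>. 0 \<le> \<delta> \<longrightarrow> \<delta> \<le> \<epsilon> \<longrightarrow>
      ch_iso sc sc (val X t) (val X (t + \<delta>)) (tr X t (t + \<delta>))) \<and>
    finite {t. t > 0 \<and> \<not> (\<exists>\<epsilon>>0. \<epsilon> \<le> t \<and> (\<forall>\<delta>. 0 \<le> \<delta> \<longrightarrow> \<delta> \<le> \<epsilon> \<longrightarrow>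
      ch_iso sc sc (val X (t - \<delta>)) (val X t) (tr X (t - \<delta>) t)))}"

definition epimorphic ::
  "('f::field \<Rightarrow> 'a::ab_group_add \<Rightarrow> 'a) \<Rightarrow> 'a pcplx \<Rightarrow> bool" where
  "epimorphic sc X \<longleftrightarrow>
    (\<forall>s t. 0 \<le> s \<longrightarrow> s \<le> t \<longrightarrow> ch_epi sc sc (val X s) (val X t) (tr X s t))"

definition factored_complex ::
  "('f::field \<Rightarrow> 'a::ab_group_add \<Rightarrow> 'a) \<Rightarrow> 'a pcplx \<Rightarrow> bool" where
  "factored_complex sc X \<longleftrightarrow> parametrized_complex sc X \<and> tame sc X \<and> epimorphic sc X"

definition pmorphism ::
  "('f::field \<Rightarrow> 'a::ab_group_add \<Rightarrow> 'a) \<Rightarrow> ('f \<Rightarrow> 'b::ab_group_add \<Rightarrow> 'b) \<Rightarrow>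
    'a pcplx \<Rightarrow> 'b pcplx \<Rightarrow> (real \<Rightarrow> nat \<Rightarrow> 'a \<Rightarrow> 'b) \<Rightarrow> bool" where
  "pmorphism sc sc' X Y \<phi> \<longleftrightarrow>
    (\<forall>t\<ge>0. ch_map sc sc' (val X t) (val Y t) (\<phi> t)) \<and>
    (\<forall>s t. 0 \<le> s \<longrightarrow> s \<le> t \<longrightarrow>
      (\<forall>i. \<forall>x\<in>ob (val X s) i. \<phi> t i (tr X s t i x) = tr Y s t i (\<phi> s i x)))"

definition pisomorphic ::
  "('f::field \<Rightarrow> 'a::ab_group_add \<Rightarrow> 'a) \<Rightarrow> ('f \<Rightarrow> 'b::ab_group_add \<Rightarrow> 'b) \<Rightarrow>
    'a pcplx \<Rightarrow> 'b pcplx \<Rightarrow> bool" where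
  "pisomorphic sc sc' X Y \<longleftrightarrow>
    (\<exists>\<phi> \<psi>. pmorphism sc sc' X Y \<phi> \<and> pmorphism sc' sc Y X \<psi> \<and>
      (\<forall>t\<ge>0. \<forall>i. \<forall>x\<in>ob (val X t) i. \<psi> t i (\<phi> t i x) = x) \<and>
      (\<forall>t\<ge>0. \<forall>i. \<forall>y\<in>ob (val Y t) i. \<phi> t i (\<psi> t i y) = y))"

section \<open>Interleaving distance\<close>

definition shift_pcplx :: "real \<Rightarrow> 'a pcplx \<Rightarrow> 'a pcplx" where
  "shift_pcplx \<epsilon> X = \<lparr>val = (\<lambda>t. val X (t + \<epsilon>)), tr = (\<lambda>s t. tr X (s + \<epsilon>) (t + \<epsilon>))\<rparr>"

definition interleaving ::
  "('f::field \<Rightarrow> 'a::ab_group_add \<Rightarrow> 'a) \<Rightarrow> ('f \<Rightarrow> 'b::ab_group_add \<Rightarrow> 'b) \<Rightarrow> real \<Rightarrow>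
    'a pcplx \<Rightarrow> 'b pcplx \<Rightarrow>
    (real \<Rightarrow> nat \<Rightarrow> 'a \<Rightarrow> 'b) \<Rightarrow> (real \<Rightarrow> nat \<Rightarrow> 'b \<Rightarrow> 'a) \<Rightarrow> bool" where
  "interleaving sc sc' \<epsilon> X Y \<phi> \<psi> \<longleftrightarrow>
    pmorphism sc sc' X (shift_pcplx \<epsilon> Y) \<phi> \<and> pmorphism sc' sc Y (shift_pcplx \<epsilon> X) \<psi> \<and>
    (\<forall>t\<ge>0. \<forall>i. \<forall>x\<in>ob (val X t) i. \<psi> (t + \<epsilon>) i (\<phi> t i x) = tr X t (t + 2 * \<epsilon>) i x) \<and>
    (\<forall>t\<ge>0. \<forall>i. \<forall>y\<in>ob (val Y t) i. \<phi> (t + \<epsilon>) i (\<psi> t i y) = tr Y t (t + 2 * \<epsilon>) i y)"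

definition interleaving_dist ::
  "('f::field \<Rightarrow> 'a::ab_group_add \<Rightarrow> 'a) \<Rightarrow> ('f \<Rightarrow> 'b::ab_group_add \<Rightarrow> 'b) \<Rightarrow>
    'a pcplx \<Rightarrow> 'b pcplx \<Rightarrow> ennreal" where
  "interleaving_dist sc sc' X Y =
    Inf {ennreal \<epsilon> | \<epsilon>. \<epsilon> > 0 \<and> (\<exists>\<phi> \<psi>. interleaving sc sc' \<epsilon> X Y \<phi> \<psi>)}"

section \<open>Interval functors and tagged barcodes\<close>

text \<open>The pair \<open>(s, t)\<close> stands for the tagged interval \<open>[0,s,t)\<close>.\<close>

type_synonym tagged_interval = "ennreal \<times> ennreal"

definition is_tagged_interval :: "tagged_interval \<Rightarrow> bool" where
  "is_tagged_interval J \<longleftrightarrow> 0 < snd J \<and> fst J \<le> snd J"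

text \<open>
  The field itself, with \<open>(*)\<close> as scalar multiplication, is the ambient one-dimensional space.
\<close>

definition disk_cplx :: "nat \<Rightarrow> 'f::field cplx" where
  "disk_cplx n = \<lparr>ob = (\<lambda>i. if i = n \<or> Suc i = n then UNIV else {0}),
             bd = (\<lambda>i x. if i = n then x else 0)\<rparr>"

definition sphere_cplx :: "nat \<Rightarrow> 'f::field cplx" where
  "sphere_cplx n = \<lparr>ob = (\<lambda>i. if i = n then UNIV else {0}), bd = (\<lambda>i x. 0)\<rparr>"

definition zero_cplx :: "'f::field cplx" where
  "zero_cplx = \<lparr>ob = (\<lambda>i. {0}), bd = (\<lambda>i x. 0)\<rparr>"

definition disk_to_sphere :: "nat \<Rightarrow> nat \<Rightarrow> 'f::field \<Rightarrow> 'f" where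
  "disk_to_sphere n i x = (if i = n then x else 0)"

text \<open>For \<open>n = 0\<close> this is only used with \<open>fst J = 0\<close>, so that \<open>disk_cplx 0\<close> does not occur.\<close>

definition interval_functor :: "nat \<Rightarrow> tagged_interval \<Rightarrow> 'f::field pcplx" where
  "interval_functor n J =
    \<lparr>val = (\<lambda>r. if ennreal r < fst J then disk_cplx n
                else if ennreal r < snd J then sphere_cplx n
                else zero_cplx),
     tr = (\<lambda>q r. if snd J \<le> ennreal r then (\<lambda>i x. 0)
                 else if ennreal q < fst J \<and> fst J \<le> ennreal r then disk_to_sphere n
                 else (\<lambda>i x. x))\<rparr>"

definition pointwise_scale :: "('f \<Rightarrow> 'a \<Rightarrow> 'a) \<Rightarrow> 'f \<Rightarrow> ('j \<Rightarrow> 'a) \<Rightarrow> 'j \<Rightarrow> 'a" where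
  "pointwise_scale sc c f = (\<lambda>j. sc c (f j))"

definition direct_sum :: "'j set \<Rightarrow> ('j \<Rightarrow> 'a::ab_group_add pcplx) \<Rightarrow> ('j \<Rightarrow> 'a) pcplx" where
  "direct_sum A Z =
    \<lparr>val = (\<lambda>t. \<lparr>ob = (\<lambda>i. {f. (\<forall>j\<in>A. f j \<in> ob (val (Z j) t) i) \<and> (\<forall>j. j \<notin> A \<longrightarrow> f j = 0) \<and>
                                finite {j. f j \<noteq> 0}}),
                  bd = (\<lambda>i f j. if j \<in> A then bd (val (Z j) t) i (f j) else 0)\<rparr>),
     tr = (\<lambda>s t i f j. if j \<in> A then tr (Z j) s t i (f j) else 0)\<rparr>"

text \<open>
  The representation of a multiset: an element of multiplicity \<open>m\<close> gives \<open>m\<close> labelled copies.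
\<close>

definition mset_rep :: "'x multiset \<Rightarrow> ('x \<times> nat) set" where
  "mset_rep A = {(x, k). k < count A x}"

definition is_tagged_barcode ::
  "('f::field \<Rightarrow> 'a::ab_group_add \<Rightarrow> 'a) \<Rightarrow> 'a pcplx \<Rightarrow>
    (nat \<Rightarrow> tagged_interval multiset) \<Rightarrow> bool" where
  "is_tagged_barcode sc X B \<longleftrightarrow>
    (\<forall>n. \<forall>J\<in>#B n. is_tagged_interval J \<and> (n = 0 \<longrightarrow> fst J = 0)) \<and>
    pisomorphic sc (pointwise_scale (*)) X
      (direct_sum (SIGMA n:UNIV. mset_rep (B n)) (\<lambda>(n, J, k). interval_functor n J))"

text \<open>
  By the structure theorem, a factored chain complex has exactly one tagged barcode.
\<close>

definition tBar ::
  "('f::field \<Rightarrow> 'a::ab_group_add \<Rightarrow> 'a) \<Rightarrow> 'a pcplx \<Rightarrow> nat \<Rightarrow> tagged_interval multiset" where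
  "tBar sc X = (THE B. is_tagged_barcode sc X B)"

section \<open>Bottleneck distance\<close>

text \<open>
  All costs are in \<open>[0, \<infinity>]\<close>, hence the type \<open>ennreal\<close>, where \<open>Sup {} = 0\<close> and \<open>Inf {} = \<infinity>\<close>.
  Subtraction on \<open>ennreal\<close> is truncated, so the sum below is the absolute difference; the case
  \<open>a = b\<close> is separate as \<open>\<infinity> - \<infinity> = \<infinity>\<close> in \<open>ennreal\<close>.
\<close>

definition abs_diff :: "ennreal \<Rightarrow> ennreal \<Rightarrow> ennreal" where
  "abs_diff a b = (if a = b then 0 else (a - b) + (b - a))"

definition pair_cost :: "tagged_interval \<Rightarrow> tagged_interval \<Rightarrow> ennreal" where
  "pair_cost J J' = max (abs_diff (fst J) (fst J')) (abs_diff (snd J) (snd J'))"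

definition unmatched_cost :: "tagged_interval \<Rightarrow> ennreal" where
  "unmatched_cost J = snd J / 2"

definition is_matching ::
  "'x multiset \<Rightarrow> 'y multiset \<Rightarrow> (('x \<times> nat) \<times> ('y \<times> nat)) set \<Rightarrow> bool" where
  "is_matching A B M \<longleftrightarrow> M \<subseteq> mset_rep A \<times> mset_rep B \<and>
    (\<forall>a b b'. (a, b) \<in> M \<longrightarrow> (a, b') \<in> M \<longrightarrow> b = b') \<and>
    (\<forall>a a' b. (a, b) \<in> M \<longrightarrow> (a', b) \<in> M \<longrightarrow> a = a')"

definition matching_cost ::
  "tagged_interval multiset \<Rightarrow> tagged_interval multiset \<Rightarrow>
    ((tagged_interval \<times> nat) \<times> (tagged_interval \<times> nat)) set \<Rightarrow> ennreal" where
  "matching_cost A B M =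
    max (SUP (a, b)\<in>M. pair_cost (fst a) (fst b))
      (max (SUP a\<in>mset_rep A - Domain M. unmatched_cost (fst a))
           (SUP b\<in>mset_rep B - Range M. unmatched_cost (fst b)))"

definition bottleneck_dist ::
  "tagged_interval multiset \<Rightarrow> tagged_interval multiset \<Rightarrow> ennreal" where
  "bottleneck_dist A B = (INF M\<in>{M. is_matching A B M}. matching_cost A B M)"

end

theory Submission
  imports Defs
begin

text \<open>
  A factored chain complex is a finite-dimensional complex \<open>C = val X 0\<close> with the ultrametric that
  sends a chain to the time at which it dies, and a tagged barcode is an orthogonal basis of \<open>C\<close>
  consisting of elements \<open>x\<close> and their nonzero boundaries, \<open>x\<close> contributing the tagged interval
  (death of the boundary of \<open>x\<close>, death of \<open>x\<close>). Such a basis is found degree by degree from the top: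
  an orthogonal basis of the boundaries is extended greedily by an element outside the current span
  that dies first and, among these, has a boundary that dies first.

  A matching of cost at most \<open>\<epsilon>\<close> gives an interleaving of the interval sums by sending generators to
  generators. Conversely, reading off the coefficients of an \<open>\<epsilon>\<close>-interleaving on the top generators of
  degree \<open>n\<close> gives matrices \<open>M\<close>, \<open>N\<close> such that \<open>N * M\<close> is the identity on the intervals with endpoint
  above \<open>2 * \<epsilon>\<close>, and a nonzero entry forces tag and endpoint to increase by at most \<open>\<epsilon>\<close>. The order by
  the sum of tag and endpoint turns this into Hall's condition for close pairs. Uniqueness of the
  barcode follows from the same stability result, applied to two barcodes of one complex.
\<close>

section \<open>Matchings from matrices\<close>

text \<open>The structure theorem is proved here rather than assumed, and \<open>tBar\<close> is a
  definite description. The isometry is therefore established for arbitrary barcodes, one \<epsilon>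
  at a time; it cannot mention \<open>tBar\<close> before uniqueness is known. Two kinds of
  generators meet in degree n: tops of intervals of degree n, and boundaries of tops of degree n +
  1. Reading off the tops alone is consistent because morphisms send boundaries to boundaries, which
  have no top component. The bound 2 * \<epsilon> matches the weight t / 2: an interleaving composes
  to the internal map from 0 to 2 * \<epsilon>, which kills exactly the tops that do not outlive 2 *
  \<epsilon>. Each of the two composites yields one injection; these need not be inverse to each
  other, so a Cantor-Bernstein argument merges them. On the algebraic side two orthogonality
  conditions must hold at once: for the whole basis of a degree, and for the boundaries of its new
  elements alone. The second criterion of the greedy choice secures the latter without damaging the
  former.\<close>

lemma hall:
  assumes "finite I" "\<And>i. i \<in> I \<Longrightarrow> finite (N i)"
    and "\<And>S. S \<subseteq> I \<Longrightarrow> card S \<le> card (\<Union>i\<in>S. N i)"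
  shows "\<exists>f. inj_on f I \<and> (\<forall>i\<in>I. f i \<in> N i)"
  using assms
proof (induction "card I" arbitrary: I N rule: less_induct)
  case less
  note fin = \<open>finite I\<close> and finN = less.prems(2) and hall = less.prems(3)
  show ?case
  proof (cases "I = {}")
    case False
    show ?thesis
    proof (cases "\<exists>S. S \<subset> I \<and> S \<noteq> {} \<and> card (\<Union>i\<in>S. N i) = card S")
      case True
      then obtain S where S: "S \<subset> I" "S \<noteq> {}" "card (\<Union>i\<in>S. N i) = card S" by blast
      have finS: "finite S" using S fin finite_subset by blast
      have "card S < card I" using S fin psubset_card_mono by blast
      then have "\<exists>f. inj_on f S \<and> (\<forall>i\<in>S. f i \<in> N i)"
        by (rule less.hyps) (use finS finN S(1) in blast, use finN S(1) in blast,
            use S(1) in \<open>intro hall, blast\<close>)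
      then obtain f where f: "inj_on f S" "\<forall>i\<in>S. f i \<in> N i" by blast
      \<comment> \<open>A tight set \<open>S\<close> uses up all of \<open>?U\<close>, so the rest
        must be matched outside it. Hall's condition survives there: it is applied to
        \<open>S \<union> T\<close>, and tightness cancels the share of \<open>S\<close>.\<close>
      let ?U = "\<Union>i\<in>S. N i"
      let ?N = "\<lambda>i. N i - ?U"
      have finU: "finite ?U" using finS finN S(1) by blast
      have "card T \<le> card (\<Union>i\<in>T. ?N i)" if T: "T \<subseteq> I - S" for T
      proof -
        have finT: "finite T" using T fin finite_subset by blast
        have "card S + card T = card (S \<union> T)"
          using T finS finT by (subst card_Un_disjoint) auto
        also have "\<dots> \<le> card (\<Union>i\<in>S \<union> T. N i)" using hall[of "S \<union> T"] T S(1) by blast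
        also have "(\<Union>i\<in>S \<union> T. N i) = ?U \<union> (\<Union>i\<in>T. ?N i)" by blast
        also have "card \<dots> \<le> card ?U + card (\<Union>i\<in>T. ?N i)" by (rule card_Un_le)
        finally show ?thesis using S(3) by simp
      qed
      moreover have "card (I - S) < card I"
        using S fin by (intro psubset_card_mono) auto
      ultimately have "\<exists>g. inj_on g (I - S) \<and> (\<forall>i\<in>I - S. g i \<in> ?N i)"
        by (intro less.hyps) (use fin finN in auto)
      then obtain g where g: "inj_on g (I - S)" "\<forall>i\<in>I - S. g i \<in> ?N i" by blast
      let ?h = "\<lambda>i. if i \<in> S then f i else g i"
      have "inj_on ?h I"
      proof (rule inj_onI)
        fix i j assume ij: "i \<in> I" "j \<in> I" "?h i = ?h j"
        have fg: "f k \<noteq> g l" if "k \<in> S" "l \<in> I - S" for k l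
          using f(2) g(2)[rule_format, OF that(2)] that by auto
        show "i = j"
          using ij f(1) g(1) fg[of i j] fg[of j i]
          by (cases "i \<in> S"; cases "j \<in> S") (simp_all add: inj_on_def)
      qed
      moreover have "\<forall>i\<in>I. ?h i \<in> N i" using f g by auto
      ultimately show ?thesis by blast
    next
      case nontight: False
      \<comment> \<open>No nonempty proper subset of \<open>I\<close> is tight, so each has a spare
        neighbour, and deleting the value chosen for \<open>i0\<close> cannot violate the
        condition.\<close>
      obtain i0 where i0: "i0 \<in> I" using False by blast
      have "card {i0} \<le> card (N i0)" using hall[of "{i0}"] i0 by simp
      then obtain x where x: "x \<in> N i0" by fastforce
      let ?I = "I - {i0}"
      let ?N = "\<lambda>i. N i - {x}"
      have "card T \<le> card (\<Union>i\<in>T. ?N i)" if T: "T \<subseteq> ?I" for T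
      proof (cases "T = {}")
        case False
        have TI: "T \<subset> I" "T \<subseteq> I" using T i0 by auto
        then have "card (\<Union>i\<in>T. N i) \<noteq> card T" using nontight False by auto
        then have lt: "card T < card (\<Union>i\<in>T. N i)" using hall[OF TI(2)] by simp
        have "(\<Union>i\<in>T. ?N i) = (\<Union>i\<in>T. N i) - {x}" by blast
        then have "card (\<Union>i\<in>T. N i) \<le> Suc (card (\<Union>i\<in>T. ?N i))"
          by (simp only: card_Diff_singleton_if split: if_split) linarith
        with lt show ?thesis by simp
      qed simp
      moreover have "card ?I < card I" using i0 fin by (meson card_Diff1_less)
      ultimately have "\<exists>g. inj_on g ?I \<and> (\<forall>i\<in>?I. g i \<in> ?N i)"
        by (intro less.hyps) (use fin finN in auto)
      then obtain g where g: "inj_on g ?I" "\<forall>i\<in>?I. g i \<in> ?N i" by blast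
      let ?h = "g(i0 := x)"
      have "inj_on ?h I" using g unfolding inj_on_def by auto
      moreover have "\<forall>i\<in>I. ?h i \<in> N i" using g x by auto
      ultimately show ?thesis by blast
    qed
  qed simp
qed

text \<open>Gaussian elimination by induction on the equations: a pivot removes one equation and one
  unknown, so the inequality of cardinalities persists.\<close>

lemma homogeneous_system_nontrivial_solution:
  fixes M :: "'k \<Rightarrow> 'j \<Rightarrow> 'f::field"
  assumes "finite B" "finite A" "card B < card A"
  shows "\<exists>c. (\<exists>j\<in>A. c j \<noteq> 0) \<and> (\<forall>k\<in>B. (\<Sum>j\<in>A. M k j * c j) = 0)"
  using assms
proof (induction B arbitrary: A M rule: finite_induct)
  case empty
  then have "A \<noteq> {}" by auto
  then show ?case by (intro exI[of _ "\<lambda>_. 1"]) auto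
next
  case (insert k0 B)
  show ?case
  proof (cases "\<forall>j\<in>A. M k0 j = 0")
    case True
    obtain c where "\<exists>j\<in>A. c j \<noteq> 0" "\<forall>k\<in>B. (\<Sum>j\<in>A. M k j * c j) = 0"
      using insert.IH[of A M] insert.prems insert.hyps by auto
    with True show ?thesis by (intro exI[of _ c]) auto
  next
    case False
    then obtain p where p: "p \<in> A" "M k0 p \<noteq> 0" by blast
    let ?A = "A - {p}"
    let ?M = "\<lambda>k j. M k j - M k p * M k0 j / M k0 p"
    have "card B < card ?A" using insert p by simp
    then obtain c where c: "\<exists>j\<in>?A. c j \<noteq> 0" "\<forall>k\<in>B. (\<Sum>j\<in>?A. ?M k j * c j) = 0"
      using insert.IH[of ?A ?M] insert.prems by auto
    \<comment> \<open>The value at \<open>p\<close> is forced by equation \<open>k0\<close>; the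
      multiples subtracted in \<open>?M\<close> are then exactly the terms of \<open>p\<close> in
      the other equations.\<close>
    define d where "d = c(p := - (\<Sum>j\<in>?A. M k0 j * c j) / M k0 p)"
    have split: "(\<Sum>j\<in>A. M k j * d j) = M k p * d p + (\<Sum>j\<in>?A. M k j * c j)" for k
    proof -
      have "(\<Sum>j\<in>A. M k j * d j) = M k p * d p + (\<Sum>j\<in>?A. M k j * d j)"
        using insert.prems p by (subst sum.remove[of A p]) auto
      also have "(\<Sum>j\<in>?A. M k j * d j) = (\<Sum>j\<in>?A. M k j * c j)"
        by (rule sum.cong) (auto simp: d_def)
      finally show ?thesis .
    qed
    have "(\<Sum>j\<in>A. M k0 j * d j) = 0" unfolding split using p by (simp add: d_def)
    moreover have "(\<Sum>j\<in>A. M k j * d j) = 0" if "k \<in> B" for k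
    proof -
      have "(\<Sum>j\<in>?A. ?M k j * c j) =
          (\<Sum>j\<in>?A. M k j * c j - M k p / M k0 p * (M k0 j * c j))"
        by (rule sum.cong) (auto simp: algebra_simps)
      also have "\<dots> = (\<Sum>j\<in>?A. M k j * c j) - M k p / M k0 p * (\<Sum>j\<in>?A. M k0 j * c j)"
        by (simp add: sum_subtractf sum_distrib_left)
      finally show ?thesis unfolding split using c(2) that p by (simp add: d_def)
    qed
    moreover have "\<exists>j\<in>A. d j \<noteq> 0" using c(1) by (auto simp: d_def)
    ultimately show ?thesis by (intro exI[of _ d]) auto
  qed
qed

text \<open>If \<open>A\<close> were larger, \<open>M\<close> would have a nonzero kernel vector
  \<open>c\<close>. In the row \<open>i\<close> of N * M with \<open>key i\<close> maximal on the
  support of \<open>c\<close>, only the diagonal term can survive, so the product does not kill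
  \<open>c\<close>.\<close>

lemma card_le_of_triangular_product:
  fixes N :: "'i \<Rightarrow> 'k \<Rightarrow> 'f::field" and key :: "'i \<Rightarrow> 'o::linorder"
  assumes "finite A" "finite B"
    and diag: "\<And>i. i \<in> A \<Longrightarrow> (\<Sum>k\<in>B. N i k * M k i) \<noteq> 0"
    and tri: "\<And>i j. i \<in> A \<Longrightarrow> j \<in> A \<Longrightarrow> i \<noteq> j \<Longrightarrow> (\<Sum>k\<in>B. N i k * M k j) \<noteq> 0 \<Longrightarrow> key i < key j"
  shows "card A \<le> card B"
proof (rule ccontr)
  assume "\<not> card A \<le> card B"
  then obtain c where c: "\<exists>j\<in>A. c j \<noteq> 0" "\<forall>k\<in>B. (\<Sum>j\<in>A. M k j * c j) = 0"
    using homogeneous_system_nontrivial_solution[of B A M] assms by auto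
  let ?S = "{j \<in> A. c j \<noteq> 0}"
  have S: "finite (key ` ?S)" "key ` ?S \<noteq> {}" using assms(1) c(1) by auto
  obtain i where i: "i \<in> A" "c i \<noteq> 0" "key i = Max (key ` ?S)" using Max_in[OF S] by auto
  have imax: "key j \<le> key i" if "j \<in> A" "c j \<noteq> 0" for j
    using that i(3) S by auto
  have "0 = (\<Sum>k\<in>B. N i k * (\<Sum>j\<in>A. M k j * c j))" using c(2) by simp
  also have "\<dots> = (\<Sum>j\<in>A. (\<Sum>k\<in>B. N i k * M k j) * c j)"
    by (simp add: sum_distrib_left sum_distrib_right mult.assoc sum.swap[of _ A B])
  also have "\<dots> = (\<Sum>j\<in>A. if j = i then (\<Sum>k\<in>B. N i k * M k i) * c i else 0)"
    using tri[OF i(1)] imax by (intro sum.cong refl) (force simp: not_less)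
  also have "\<dots> = (\<Sum>k\<in>B. N i k * M k i) * c i" using assms(1) i(1) by simp
  finally show False using diag[OF i(1)] i(2) by simp
qed

text \<open>
  A product of entries through an index far from all of \<open>S\<close> strictly increases the sum of the
  weights, so removing these indices leaves a triangular matrix, which gives Hall's condition.
\<close>

lemma matching_of_matrices:
  fixes N :: "'i \<Rightarrow> 'k \<Rightarrow> 'f::field" and sa ta :: "'i \<Rightarrow> real" and sb tb :: "'k \<Rightarrow> real"
  assumes "finite A" "finite B"
    and M: "\<And>k j. k \<in> B \<Longrightarrow> j \<in> A \<Longrightarrow> M k j \<noteq> 0 \<Longrightarrow> sb k \<le> sa j + \<epsilon> \<and> tb k \<le> ta j + \<epsilon>"
    and N: "\<And>i k. k \<in> B \<Longrightarrow> i \<in> A \<Longrightarrow> N i k \<noteq> 0 \<Longrightarrow> sa i \<le> sb k + \<epsilon> \<and> ta i \<le> tb k + \<epsilon>"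
    and NM: "\<And>i j. i \<in> A \<Longrightarrow> j \<in> A \<Longrightarrow> (\<Sum>k\<in>B. N i k * M k j) = (if i = j then 1 else 0)"
  shows "\<exists>f. inj_on f A \<and> (\<forall>i\<in>A. f i \<in> B \<and> \<bar>sa i - sb (f i)\<bar> \<le> \<epsilon> \<and> \<bar>ta i - tb (f i)\<bar> \<le> \<epsilon>)"
proof -
  define Nb where "Nb i = {k \<in> B. \<bar>sa i - sb k\<bar> \<le> \<epsilon> \<and> \<bar>ta i - tb k\<bar> \<le> \<epsilon>}" for i
  have "card S \<le> card (\<Union>i\<in>S. Nb i)" if S: "S \<subseteq> A" for S
  proof -
    let ?B = "\<Union>i\<in>S. Nb i"
    let ?key = "\<lambda>i. sa i + ta i"
    have BB: "?B \<subseteq> B" by (auto simp: Nb_def)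
    \<comment> \<open>Being far from \<open>i\<close> means that one coordinate of \<open>k\<close>
      exceeds that of \<open>i\<close> by more than \<epsilon>, while the other drops by at most
      \<epsilon>; so the sum grows strictly from \<open>i\<close> to \<open>k\<close>. The same
      holds from \<open>k\<close> to \<open>j\<close>.\<close>
    have far: "?key i < ?key j"
      if ij: "i \<in> S" "j \<in> S" and k: "k \<in> B - ?B" "N i k * M k j \<noteq> 0" for i j k
    proof -
      have 1: "sb k \<le> sa j + \<epsilon>" "tb k \<le> ta j + \<epsilon>" "sa i \<le> sb k + \<epsilon>" "ta i \<le> tb k + \<epsilon>"
        using M[of k j] N[of k i] ij S k by auto
      have "\<not> (\<bar>sa i - sb k\<bar> \<le> \<epsilon> \<and> \<bar>ta i - tb k\<bar> \<le> \<epsilon>)"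
        "\<not> (\<bar>sa j - sb k\<bar> \<le> \<epsilon> \<and> \<bar>ta j - tb k\<bar> \<le> \<epsilon>)"
        using k(1) ij by (auto simp: Nb_def)
      with 1 show ?thesis by (auto simp: abs_le_iff not_le)
    qed
    have split: "(\<Sum>k\<in>B. N i k * M k j) = (\<Sum>k\<in>?B. N i k * M k j) + (\<Sum>k\<in>B - ?B. N i k * M k j)"
      for i j using sum.subset_diff[OF BB assms(2), of "\<lambda>k. N i k * M k j"] by (simp only: add.commute)
    show ?thesis
    proof (rule card_le_of_triangular_product[where key = ?key and N = N and M = M])
      show "finite S" using S assms(1) finite_subset by blast
      show "finite ?B" using BB assms(2) finite_subset by blast
    next
      fix i assume i: "i \<in> S"
      \<comment> \<open>For equal indices \<open>far\<close> would give
        \<open>?key i < ?key i\<close>, so every term vanishes.\<close>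
      have "(\<Sum>k\<in>B - ?B. N i k * M k i) = 0"
        by (rule sum.neutral) (use far[OF i i] in blast)
      then have "(\<Sum>k\<in>?B. N i k * M k i) = 1" using split[of i i] NM[of i i] i S by auto
      then show "(\<Sum>k\<in>?B. N i k * M k i) \<noteq> 0" by simp
    next
      fix i j assume ij: "i \<in> S" "j \<in> S" "i \<noteq> j" "(\<Sum>k\<in>?B. N i k * M k j) \<noteq> 0"
      have "(\<Sum>k\<in>B - ?B. N i k * M k j) \<noteq> 0"
        using split[of i j] NM[of i j] ij S by (auto simp: subset_iff)
      then show "?key i < ?key j" using far[OF ij(1,2)] by (meson sum.neutral)
    qed
  qed
  moreover have "finite (Nb i)" for i using assms(2) by (auto simp: Nb_def)
  ultimately obtain f where "inj_on f A" "\<forall>i\<in>A. f i \<in> Nb i"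
    using hall[of A Nb] assms(1) by blast
  then show ?thesis by (auto simp: Nb_def intro!: exI[of _ f])
qed

text \<open>Cantor-Bernstein argument for injections that may leave \<open>B\<close> and
  \<open>A\<close>: the fixed point \<open>S\<close> is the part of \<open>A\<close> matched by
  \<open>f\<close>, and the elements of \<open>B\<close> not reached from \<open>S\<close> are
  matched by \<open>g\<close>. The bounds on domain and range record where partners outside
  \<open>A\<close> and \<open>B\<close> come from.\<close>

lemma matching_of_injections:
  assumes f: "inj_on f A" "\<And>a. a \<in> A \<Longrightarrow> R a (f a)"
    and g: "inj_on g B" "\<And>b. b \<in> B \<Longrightarrow> R (g b) b"
  shows "\<exists>M. (\<forall>(a, b)\<in>M. R a b) \<and> A \<subseteq> Domain M \<and> B \<subseteq> Range M \<and> Domain M \<subseteq> A \<union> g ` B \<and>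
    Range M \<subseteq> B \<union> f ` A \<and>
    (\<forall>a b b'. (a, b) \<in> M \<longrightarrow> (a, b') \<in> M \<longrightarrow> b = b') \<and>
    (\<forall>a a' b. (a, b) \<in> M \<longrightarrow> (a', b) \<in> M \<longrightarrow> a = a')"
proof -
  define \<Phi> where "\<Phi> S = A - g ` (B - f ` S)" for S
  have "mono \<Phi>" unfolding \<Phi>_def by (intro monoI) blast
  then obtain S where S: "S = A - g ` (B - f ` S)"
    using lfp_unfold[of \<Phi>] unfolding \<Phi>_def by blast
  define M where "M = (\<lambda>a. (a, f a)) ` S \<union> (\<lambda>b. (g b, b)) ` (B - f ` S)"
  have SA: "S \<subseteq> A" using S by blast
  have gS: "g b \<notin> S" if "b \<in> B - f ` S" for b using S that by blast
  have 1: "\<forall>a b b'. (a, b) \<in> M \<longrightarrow> (a, b') \<in> M \<longrightarrow> b = b'"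
    unfolding M_def using gS g(1) by (auto dest: inj_onD)
  have 2: "\<forall>a a' b. (a, b) \<in> M \<longrightarrow> (a', b) \<in> M \<longrightarrow> a = a'"
    unfolding M_def using f(1) SA by (auto dest: inj_onD)
  have 3: "A \<subseteq> Domain M" "B \<subseteq> Range M"
    using S unfolding M_def by (auto simp: Domain.simps Range.simps image_iff) blast+
  have 4: "\<forall>(a, b)\<in>M. R a b" unfolding M_def using f g SA by auto
  have 5: "Domain M \<subseteq> A \<union> g ` B" "Range M \<subseteq> B \<union> f ` A" using SA unfolding M_def by auto
  show ?thesis using 1 2 3 4 5 by blast
qed

text \<open>The matrix argument compares sums of a tag and an endpoint, which fails at \<infinity>.
  Replacing \<infinity> by a real number that exceeds all finite values by more than \<epsilon>
  preserves every comparison up to \<epsilon>.\<close>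

lemma ennreal_truncation:
  assumes "finite S" "\<epsilon> \<ge> 0"
  shows "\<exists>h. \<forall>x\<in>S. \<forall>y\<in>S. h x \<le> h y + \<epsilon> \<longleftrightarrow> x \<le> y + ennreal \<epsilon>"
proof -
  \<comment> \<open>The summand 1 makes the gap strictly larger than \<epsilon>, so that no finite
    value counts as \<epsilon>-close to \<infinity>.\<close>
  define L where "L = Max (insert 0 (enn2real ` S)) + \<epsilon> + 1"
  define h where "h x = (if x = \<infinity> then L else enn2real x)" for x
  have L: "enn2real x + \<epsilon> < L" if "x \<in> S" for x
  proof -
    have "enn2real x \<le> Max (insert 0 (enn2real ` S))" using assms that by (intro Max_ge) auto
    then show ?thesis unfolding L_def by simp
  qed
  have "h x \<le> h y + \<epsilon> \<longleftrightarrow> x \<le> y + ennreal \<epsilon>" if "x \<in> S" "y \<in> S" for x y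
  proof (cases x; cases y)
    fix a b :: real assume a: "0 \<le> a" "x = ennreal a" and b: "0 \<le> b" "y = ennreal b"
    then show ?thesis using assms by (simp add: h_def flip: ennreal_plus)
  next
    fix a :: real assume a: "0 \<le> a" "x = ennreal a" and b: "y = top"
    then show ?thesis using assms L[OF that(1)] by (simp add: h_def)
  next
    fix b :: real assume b: "0 \<le> b" "y = ennreal b" and a: "x = top"
    then show ?thesis using assms L[OF that(2)] by (simp add: h_def top_unique)
  next
    assume "x = top" "y = top"
    then show ?thesis using assms by (simp add: h_def)
  qed
  then show ?thesis by blast
qed

text \<open>The two one-sided bounds are what nonzero matrix entries supply, and they treat
  \<infinity> correctly.\<close>

lemma abs_diff_le_iff: "abs_diff a b \<le> e \<longleftrightarrow> a \<le> b + e \<and> b \<le> a + e"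
proof (cases "a = b")
  case False
  have "a - b \<le> e \<longleftrightarrow> a \<le> b + e" "b - a \<le> e \<longleftrightarrow> b \<le> a + e"
    using False by (auto simp: ennreal_minus_le_iff add.commute)
  moreover have "a - b = 0 \<or> b - a = 0"
    using False by (metis diff_eq_0_iff_ennreal less_top linear top.extremum_unique)
  ultimately show ?thesis using False by (auto simp: abs_diff_def add_increasing)
qed (simp add: abs_diff_def)

section \<open>Direct sums of interval functors\<close>

text \<open>The pairs (r, i) at which the interval functor is one-dimensional: the top generator
  lives until the endpoint, its boundary in degree n - 1 until the tag. Values, differentials and
  internal maps can then all be expressed by restricting coefficients to what is live.\<close>

definition live :: "nat \<Rightarrow> tagged_interval \<Rightarrow> real \<Rightarrow> nat \<Rightarrow> bool" where
  "live n J r i \<longleftrightarrow> i = n \<and> ennreal r < snd J \<or> Suc i = n \<and> ennreal r < fst J"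

lemma live_mono: "live n J r i \<Longrightarrow> q \<le> r \<Longrightarrow> live n J q i"
  by (auto simp: live_def dest: le_less_trans[OF ennreal_leI])

lemma ob_interval:
  assumes "fst J \<le> snd J"
  shows "ob (val (interval_functor n J) r) i = (if live n J r i then UNIV else {0})"
  using assms
  by (auto simp: interval_functor_def live_def disk_cplx_def sphere_cplx_def zero_cplx_def)

lemma bd_interval:
  assumes "fst J \<le> snd J"
  shows "bd (val (interval_functor n J) r) (Suc i) x =
    (if n = Suc i \<and> live n J r i then x else 0)"
proof (cases "ennreal r < fst J")
  case True
  then show ?thesis
    by (cases "n = Suc i") (simp_all add: interval_functor_def live_def disk_cplx_def)
next
  case False
  then have "\<not> (n = Suc i \<and> live n J r i)" by (auto simp: live_def)
  moreover have "bd (val (interval_functor n J) r) (Suc i) x = 0"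
    using False by (simp add: interval_functor_def sphere_cplx_def zero_cplx_def)
  ultimately show ?thesis by (simp only: if_False)
qed

lemma tr_interval:
  assumes "fst J \<le> snd J" "x \<in> ob (val (interval_functor n J) q) i" "q \<le> r"
  shows "tr (interval_functor n J) q r i x = (if live n J r i then x else 0)"
proof -
  have *: "ennreal q \<le> ennreal r" using assms(3) by (rule ennreal_leI)
  consider "snd J \<le> ennreal r" | "ennreal r < snd J" "ennreal q < fst J" "fst J \<le> ennreal r"
    | "ennreal r < snd J" "ennreal r < fst J" | "ennreal r < snd J" "fst J \<le> ennreal q"
    by (meson not_le)
  then show ?thesis
    using assms(1,2) *
    by cases (auto simp: interval_functor_def live_def disk_to_sphere_def disk_cplx_def
        sphere_cplx_def zero_cplx_def split: if_splits)
qed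

text \<open>The index set is abstract because two kinds of families occur: one indexed by chosen
  basis elements, one by numbered copies from multisets.\<close>

locale interval_family =
  fixes A :: "'j set" and deg :: "'j \<Rightarrow> nat" and itv :: "'j \<Rightarrow> tagged_interval"
  assumes pos: "j \<in> A \<Longrightarrow> 0 < snd (itv j)"
    and tag_le: "j \<in> A \<Longrightarrow> fst (itv j) \<le> snd (itv j)"
    and tag_0: "j \<in> A \<Longrightarrow> deg j = 0 \<Longrightarrow> fst (itv j) = 0"
begin

definition isum :: "('j \<Rightarrow> 'f::field) pcplx" where
  "isum = direct_sum A (\<lambda>j. interval_functor (deg j) (itv j))"

abbreviation alive :: "'j \<Rightarrow> real \<Rightarrow> nat \<Rightarrow> bool" where
  "alive j \<equiv> live (deg j) (itv j)"

lemma ob_isum: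
  "ob (val isum r) i = {h. finite {j. h j \<noteq> 0} \<and> (\<forall>j. h j \<noteq> 0 \<longrightarrow> j \<in> A \<and> alive j r i)}"
proof -
  have "(\<forall>j\<in>A. h j \<in> ob (val (interval_functor (deg j) (itv j)) r) i) \<longleftrightarrow>
      (\<forall>j\<in>A. h j \<noteq> 0 \<longrightarrow> alive j r i)" for h :: "'j \<Rightarrow> 'f::field"
    by (intro ball_cong) (auto simp: ob_interval[OF tag_le])
  then show ?thesis unfolding isum_def direct_sum_def by (auto; metis)
qed

lemma isum_supp:
  "h \<in> ob (val isum r) i \<Longrightarrow> h j \<noteq> 0 \<Longrightarrow> j \<in> A \<and> alive j r i"
  by (simp add: ob_isum)

lemma bd_isum:
  assumes "h \<in> ob (val isum r) (Suc i)"
  shows "bd (val isum r) (Suc i) h = (\<lambda>j. if deg j = Suc i \<and> alive j r i then h j else 0)"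
proof
  fix j
  show "bd (val isum r) (Suc i) h j = (if deg j = Suc i \<and> alive j r i then h j else 0)"
  proof (cases "j \<in> A")
    case True
    then show ?thesis using bd_interval[OF tag_le[OF True], of "deg j" r i "h j"]
      by (simp add: isum_def direct_sum_def)
  next
    case False
    then have "h j = 0" using isum_supp[OF assms(1), of j] by blast
    then show ?thesis using False by (simp add: isum_def direct_sum_def)
  qed
qed

lemma tr_isum:
  assumes "h \<in> ob (val isum q) i" "q \<le> r"
  shows "tr isum q r i h = (\<lambda>j. if alive j r i then h j else 0)"
proof
  fix j
  show "tr isum q r i h j = (if alive j r i then h j else 0)"
  proof (cases "j \<in> A")
    case True
    have "h j \<in> ob (val (interval_functor (deg j) (itv j)) q) i"
      using isum_supp[OF assms(1), of j] by (auto simp: ob_interval[OF tag_le[OF True]])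
    then show ?thesis using True tr_interval[OF tag_le[OF True] _ assms(2), of "h j" "deg j" i]
      by (simp add: isum_def direct_sum_def)
  next
    case False
    then have "h j = 0" using isum_supp[OF assms(1), of j] by blast
    then show ?thesis using False by (auto simp: isum_def direct_sum_def)
  qed
qed

definition gen :: "'j \<Rightarrow> 'j \<Rightarrow> 'f::field" where
  "gen j = (\<lambda>i. if i = j then 1 else 0)"

lemma gen_in_isum:
  assumes "j \<in> A"
  shows "gen j \<in> ob (val isum r) i \<longleftrightarrow> alive j r i"
  using assms by (simp add: ob_isum gen_def)

lemma alive_0:
  assumes "j \<in> A"
  shows "alive j 0 (deg j)"
  using pos[OF assms] by (simp add: live_def)

end

section \<open>From interleavings to matchings\<close>

lemma lin_mapD:
  assumes "lin_map sc sc' V W f"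
  shows "x \<in> V \<Longrightarrow> f x \<in> W" "x \<in> V \<Longrightarrow> y \<in> V \<Longrightarrow> f (x + y) = f x + f y"
    "x \<in> V \<Longrightarrow> f (sc c x) = sc' c (f x)"
  using assms by (auto simp: lin_map_def)

lemma ch_mapD:
  assumes "ch_map sc sc' C D f"
  shows "lin_map sc sc' (ob C i) (ob D i) (f i)"
    "x \<in> ob C (Suc i) \<Longrightarrow> f i (bd C (Suc i) x) = bd D (Suc i) (f (Suc i) x)"
  using assms by (auto simp: ch_map_def)

lemma pmorphismD:
  assumes "pmorphism sc sc' X Y \<phi>"
  shows "0 \<le> t \<Longrightarrow> ch_map sc sc' (val X t) (val Y t) (\<phi> t)"
    "0 \<le> s \<Longrightarrow> s \<le> t \<Longrightarrow> x \<in> ob (val X s) i \<Longrightarrow> \<phi> t i (tr X s t i x) = tr Y s t i (\<phi> s i x)"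
  using assms by (auto simp: pmorphism_def)

lemma shift_simps [simp]:
  "val (shift_pcplx \<epsilon> X) t = val X (t + \<epsilon>)" "tr (shift_pcplx \<epsilon> X) s t = tr X (s + \<epsilon>) (t + \<epsilon>)"
  by (simp_all add: shift_pcplx_def)

lemma interleaving_commute:
  "interleaving sc sc' \<epsilon> X Y \<phi> \<psi> \<longleftrightarrow> interleaving sc' sc \<epsilon> Y X \<psi> \<phi>"
  by (auto simp: interleaving_def)

lemma lin_map_sum:
  assumes "module sc" "module sc'" "lin_map sc sc' V W f" "module.subspace sc V"
    and "\<And>k. k \<in> S \<Longrightarrow> x k \<in> V"
  shows "f (\<Sum>k\<in>S. sc (c k) (x k)) = (\<Sum>k\<in>S. sc' (c k) (f (x k)))"
proof -
  interpret X: module sc by fact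
  interpret Y: module sc' by fact
  have f0: "f 0 = 0"
    using lin_mapD(3)[OF assms(3) X.subspace_0[OF assms(4)], of 0] by simp
  show ?thesis
    using assms(5)
  proof (induction S rule: infinite_finite_induct)
    case (insert k S)
    have "sc (c k) (x k) \<in> V" "(\<Sum>k\<in>S. sc (c k) (x k)) \<in> V"
      using insert.prems by (auto intro!: X.subspace_sum X.subspace_scale assms(4))
    then show ?case
      using insert lin_mapD[OF assms(3)] by auto
  qed (use f0 in auto)
qed

lemma lin_map_zero:
  assumes "module sc" "module sc'" "lin_map sc sc' V W f" "module.subspace sc V"
  shows "f 0 = 0"
  using lin_map_sum[OF assms, of "{}"] by simp

lemma vector_space_pointwise_scale: "vector_space (pointwise_scale ((*) :: 'f::field \<Rightarrow> _))"
  by unfold_locales (auto simp: pointwise_scale_def fun_eq_iff algebra_simps)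

lemma module_pointwise_scale: "module (pointwise_scale ((*) :: 'f::field \<Rightarrow> _))"
  using vector_space_pointwise_scale by (simp add: module_iff_vector_space)

lemma sum_apply: "(\<Sum>k\<in>S. f k) i = (\<Sum>k\<in>S. f k i)"
  by (induction S rule: infinite_finite_induct) auto

context interval_family
begin

lemma subspace_isum:
  "module.subspace (pointwise_scale (*)) (ob (val (isum :: ('j \<Rightarrow> 'f::field) pcplx) r) i)"
proof -
  interpret vector_space "pointwise_scale (*) :: 'f \<Rightarrow> ('j \<Rightarrow> 'f) \<Rightarrow> _"
    by (rule vector_space_pointwise_scale)
  show ?thesis
  proof (rule subspaceI)
    fix x y :: "'j \<Rightarrow> 'f"
    assume *: "x \<in> ob (val isum r) i" "y \<in> ob (val isum r) i"
    then have "finite ({j. x j \<noteq> 0} \<union> {j. y j \<noteq> 0})" by (simp add: ob_isum)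
    then have "finite {j. (x + y) j \<noteq> 0}" by (rule rev_finite_subset) auto
    then show "x + y \<in> ob (val isum r) i"
      using * by (auto simp: ob_isum) (metis add.right_neutral)+
  next
    fix c and x :: "'j \<Rightarrow> 'f"
    assume *: "x \<in> ob (val isum r) i"
    then have "finite {j. x j \<noteq> 0}" by (simp add: ob_isum)
    then have "finite {j. pointwise_scale (*) c x j \<noteq> 0}"
      by (rule rev_finite_subset) (auto simp: pointwise_scale_def)
    then show "pointwise_scale (*) c x \<in> ob (val isum r) i"
      using * by (auto simp: ob_isum pointwise_scale_def)
  qed (simp add: ob_isum)
qed

lemma tr_isum_in:
  assumes "h \<in> ob (val isum q) i" "q \<le> r"
  shows "tr isum q r i h \<in> ob (val isum r) i"
proof -
  have "finite {j. h j \<noteq> 0}" using assms by (simp add: ob_isum)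
  then have "finite {j. (if alive j r i then h j else 0) \<noteq> 0}" by (rule rev_finite_subset) auto
  then show ?thesis unfolding tr_isum[OF assms] using isum_supp[OF assms(1)]
    by (auto simp: ob_isum split: if_splits)
qed

end

locale two_interval_families = X: interval_family A deg itv + Y: interval_family A' deg' itv'
  for A :: "'i set" and deg itv and A' :: "'k set" and deg' itv'
begin

text \<open>Naturality at the endpoint of \<open>j\<close>: the generator is zero there, so its
  image is zero \<epsilon> later, and \<open>k\<close> must be dead by then. The tag is treated in
  the same way through the differential: once the generator is a cycle, so is its image. Since
  \<open>deg' k = n\<close>, the index \<open>k\<close> is a top generator there, which becomes a
  cycle only at its tag.\<close>

lemma morphism_entry:
  fixes \<phi> :: "real \<Rightarrow> nat \<Rightarrow> ('i \<Rightarrow> 'f::field) \<Rightarrow> 'k \<Rightarrow> 'f"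
  assumes \<phi>: "pmorphism (pointwise_scale (*)) (pointwise_scale (*)) X.isum (shift_pcplx \<epsilon> Y.isum) \<phi>"
    and \<epsilon>: "\<epsilon> > 0" and j: "j \<in> A" "deg j = n" and k: "deg' k = n"
    and nz: "\<phi> 0 n (X.gen j) k \<noteq> 0"
  shows "k \<in> A'" "fst (itv' k) \<le> fst (itv j) + ennreal \<epsilon>" "snd (itv' k) \<le> snd (itv j) + ennreal \<epsilon>"
proof -
  let ?g = "X.gen j :: 'i \<Rightarrow> 'f"
  let ?y = "\<phi> 0 n ?g"
  have lin: "lin_map (pointwise_scale (*)) (pointwise_scale (*)) (ob (val X.isum t) i)
      (ob (val Y.isum (t + \<epsilon>)) i) (\<phi> t i)" if "0 \<le> t" for t i
    using ch_mapD(1)[OF pmorphismD(1)[OF \<phi> that]] by simp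
  have g: "?g \<in> ob (val X.isum 0) n" using X.alive_0[OF j(1)] j by (simp add: X.gen_in_isum)
  then have y: "?y \<in> ob (val Y.isum \<epsilon>) n" using lin_mapD(1)[OF lin[of 0]] by simp
  show kA: "k \<in> A'" using Y.isum_supp[OF y nz] by simp
  have \<phi>0: "\<phi> t i 0 = 0" if "0 \<le> t" for t i
    by (rule lin_map_zero[OF module_pointwise_scale module_pointwise_scale lin[OF that] X.subspace_isum])
  have natural: "\<phi> t n (tr X.isum 0 t n ?g) = tr Y.isum \<epsilon> (t + \<epsilon>) n ?y" if "0 \<le> t" for t
    using pmorphismD(2)[OF \<phi> order_refl that g] by simp
  have trg: "tr X.isum 0 t n ?g = (\<lambda>i. if X.alive i t n then ?g i else 0)" if "0 \<le> t" for t
    by (rule X.tr_isum[OF g that])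
  have try_eq: "tr Y.isum \<epsilon> (t + \<epsilon>) n ?y = (\<lambda>i. if Y.alive i (t + \<epsilon>) n then ?y i else 0)"
    if "0 \<le> t" for t by (rule Y.tr_isum[OF y]) (use that in simp)
  show "snd (itv' k) \<le> snd (itv j) + ennreal \<epsilon>"
  proof (cases "snd (itv j)")
    case (real t)
    have "tr X.isum 0 t n ?g = 0"
      unfolding trg[OF real(1)] using real j(2) by (auto simp: X.gen_def live_def fun_eq_iff)
    then have "tr Y.isum \<epsilon> (t + \<epsilon>) n ?y = 0" using natural[of t] \<phi>0 real by simp
    then have "\<not> Y.alive k (t + \<epsilon>) n" using fun_cong[OF try_eq[of t], of k] nz real by auto
    then show ?thesis using k real \<epsilon> by (simp add: live_def not_less ennreal_plus)
  qed simp
  show "fst (itv' k) \<le> fst (itv j) + ennreal \<epsilon>"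
  proof (cases n)
    case 0
    then show ?thesis using Y.tag_0[OF kA] k by simp
  next
    case (Suc m)
    show ?thesis
    proof (cases "fst (itv j)")
      case (real s)
      let ?x = "tr X.isum 0 s n ?g"
      have x: "?x \<in> ob (val X.isum s) (Suc m)" using X.tr_isum_in[OF g] real Suc by simp
      have "bd (val X.isum s) (Suc m) ?x = 0"
        unfolding X.bd_isum[OF x] unfolding trg[OF real(1)] using real j(2) Suc
        by (auto simp: X.gen_def live_def fun_eq_iff)
      then have "bd (val Y.isum (s + \<epsilon>)) (Suc m) (\<phi> s (Suc m) ?x) = 0"
        using ch_mapD(2)[OF pmorphismD(1)[OF \<phi>, of s] x] real \<phi>0 by simp
      then have *: "bd (val Y.isum (s + \<epsilon>)) (Suc m) (tr Y.isum \<epsilon> (s + \<epsilon>) n ?y) = 0"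
        using natural[of s] real Suc by simp
      have ty: "tr Y.isum \<epsilon> (s + \<epsilon>) n ?y \<in> ob (val Y.isum (s + \<epsilon>)) (Suc m)"
        using Y.tr_isum_in[OF y, of "s + \<epsilon>"] real Suc by simp
      have "\<not> (Y.alive k (s + \<epsilon>) m \<and> Y.alive k (s + \<epsilon>) n)"
        using fun_cong[OF *, of k, unfolded Y.bd_isum[OF ty]]
          fun_cong[OF try_eq[OF real(1)], of k] nz k Suc by auto
      then have "\<not> ennreal (s + \<epsilon>) < fst (itv' k)"
        using k Suc Y.tag_le[OF kA] by (auto simp: live_def)
      then show ?thesis using real \<epsilon> by (simp add: not_less ennreal_plus)
    qed simp
  qed
qed

text \<open>A chain of degree n at time \<epsilon> is a combination of top generators transported
  from time 0, plus a boundary. Boundaries go to boundaries, which have coefficient 0 at the top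
  generator \<open>i\<close>. As \<open>i\<close> outlives 2 * \<epsilon>, the internal map from
  \<epsilon> to 2 * \<epsilon> leaves its coefficient alone, so the matrix at time 0
  suffices.\<close>

lemma morphism_coordinate:
  fixes \<psi> :: "real \<Rightarrow> nat \<Rightarrow> ('k \<Rightarrow> 'f::field) \<Rightarrow> 'i \<Rightarrow> 'f"
  assumes \<psi>: "pmorphism (pointwise_scale (*)) (pointwise_scale (*)) Y.isum (shift_pcplx \<epsilon> X.isum) \<psi>"
    and \<epsilon>: "\<epsilon> > 0" and fin: "finite {k \<in> A'. deg' k = n}"
    and i: "i \<in> A" "deg i = n" "ennreal (2 * \<epsilon>) < snd (itv i)"
    and y: "y \<in> ob (val Y.isum \<epsilon>) n"
  shows "\<psi> \<epsilon> n y i = (\<Sum>k | k \<in> A' \<and> deg' k = n. y k * \<psi> 0 n (Y.gen k) i)"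
proof -
  let ?S = "{k \<in> A'. deg' k = n}"
  let ?tg = "\<lambda>k. tr Y.isum 0 \<epsilon> n (Y.gen k :: 'k \<Rightarrow> 'f)"
  \<comment> \<open>The part of \<open>y\<close> on generators of degree n + 1, which occur in
    degree n through their boundaries. The same function, read in degree n + 1, is a chain with
    boundary \<open>w\<close>, since the differential of a disk is the identity.\<close>
  define w where "w k = (if deg' k = Suc n then y k else 0)" for k
  have lin: "lin_map (pointwise_scale (*)) (pointwise_scale (*)) (ob (val Y.isum t) i)
      (ob (val X.isum (t + \<epsilon>)) i) (\<psi> t i)" if "0 \<le> t" for t i
    using ch_mapD(1)[OF pmorphismD(1)[OF \<psi> that]] by simp
  have g: "(Y.gen k :: 'k \<Rightarrow> 'f) \<in> ob (val Y.isum 0) n" if "k \<in> ?S" for k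
    using Y.gen_in_isum[of k] Y.alive_0[of k] that by auto
  have tgin: "?tg k \<in> ob (val Y.isum \<epsilon>) n" if "k \<in> ?S" for k
    using Y.tr_isum_in[OF g[OF that]] \<epsilon> by simp
  have ylive: "k \<in> A' \<and> live (Suc n) (itv' k) \<epsilon> n" if "deg' k = Suc n" "y k \<noteq> 0" for k
    using Y.isum_supp[OF y that(2)] that(1) by simp
  have "finite {k. y k \<noteq> 0}" using y by (simp add: Y.ob_isum)
  then have "finite {k. w k \<noteq> 0}" by (rule rev_finite_subset) (auto simp: w_def)
  then have w: "w \<in> ob (val Y.isum \<epsilon>) (Suc n)"
    using Y.isum_supp[OF y] Y.tag_le by (auto simp: Y.ob_isum w_def live_def split: if_splits)
      (meson less_le_trans)
  have bw: "bd (val Y.isum \<epsilon>) (Suc n) w = w"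
    unfolding Y.bd_isum[OF w] using ylive by (auto simp: w_def fun_eq_iff)
  then have win: "w \<in> ob (val Y.isum \<epsilon>) n"
    using w y ylive unfolding Y.ob_isum by (auto simp: w_def split: if_splits)
  have "y = (\<Sum>k\<in>?S. pointwise_scale (*) (y k) (?tg k)) + w"
  proof
    fix l
    have "(\<Sum>k\<in>?S. y k * ?tg k l) = (\<Sum>k\<in>?S. if k = l then y l else 0)"
    proof (rule sum.cong)
      fix k assume k: "k \<in> ?S"
      show "y k * ?tg k l = (if k = l then y l else 0)"
        unfolding Y.tr_isum[OF g[OF k] less_imp_le[OF \<epsilon>]]
        using Y.isum_supp[OF y, of l] by (auto simp: Y.gen_def)
    qed simp
    also have "\<dots> = (if l \<in> ?S then y l else 0)" using fin by simp
    also have "\<dots> = y l - w l"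
      using Y.isum_supp[OF y, of l] by (cases "y l = 0") (auto simp: w_def live_def)
    finally show "y l = ((\<Sum>k\<in>?S. pointwise_scale (*) (y k) (?tg k)) + w) l"
      by (simp add: sum_apply pointwise_scale_def)
  qed
  moreover have "\<psi> \<epsilon> n w i = 0"
  proof -
    have "\<psi> \<epsilon> n w i = bd (val X.isum (\<epsilon> + \<epsilon>)) (Suc n) (\<psi> \<epsilon> (Suc n) w) i"
      using ch_mapD(2)[OF pmorphismD(1)[OF \<psi>, of \<epsilon>] w] bw \<epsilon> by simp
    also have "\<dots> = 0"
      using X.bd_isum[OF lin_mapD(1)[OF lin w]] \<epsilon> i(2) by simp
    finally show ?thesis .
  qed
  moreover have "\<psi> \<epsilon> n (?tg k) i = \<psi> 0 n (Y.gen k) i" if k: "k \<in> ?S" for k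
  proof -
    have "\<psi> \<epsilon> n (?tg k) i = tr X.isum \<epsilon> (\<epsilon> + \<epsilon>) n (\<psi> 0 n (Y.gen k)) i"
      using pmorphismD(2)[OF \<psi> order_refl _ g[OF k], of \<epsilon>] \<epsilon> by simp
    also have "\<dots> = \<psi> 0 n (Y.gen k) i"
      using X.tr_isum[of "\<psi> 0 n (Y.gen k)" \<epsilon> n "\<epsilon> + \<epsilon>"] lin_mapD(1)[OF lin[of 0] g[OF k]] \<epsilon> i
      by (simp add: live_def)
    finally show ?thesis .
  qed
  moreover have "\<psi> \<epsilon> n ((\<Sum>k\<in>?S. pointwise_scale (*) (y k) (?tg k)) + w) =
      (\<Sum>k\<in>?S. pointwise_scale (*) (y k) (\<psi> \<epsilon> n (?tg k))) + \<psi> \<epsilon> n w"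
  proof -
    interpret YV: vector_space "pointwise_scale (*) :: 'f \<Rightarrow> ('k \<Rightarrow> 'f) \<Rightarrow> _"
      by (rule vector_space_pointwise_scale)
    have "(\<Sum>k\<in>?S. pointwise_scale (*) (y k) (?tg k)) \<in> ob (val Y.isum \<epsilon>) n"
      using tgin by (intro YV.subspace_sum YV.subspace_scale Y.subspace_isum)
    then have "\<psi> \<epsilon> n ((\<Sum>k\<in>?S. pointwise_scale (*) (y k) (?tg k)) + w) =
        \<psi> \<epsilon> n (\<Sum>k\<in>?S. pointwise_scale (*) (y k) (?tg k)) + \<psi> \<epsilon> n w"
      using lin_mapD(2)[OF lin _ win] \<epsilon> by simp
    then show ?thesis
      using lin_map_sum[OF module_pointwise_scale module_pointwise_scale lin[OF less_imp_le[OF \<epsilon>]]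
        Y.subspace_isum, where x = ?tg and S = ?S and c = y, OF tgin] by simp
  qed
  ultimately show ?thesis by (simp add: sum_apply pointwise_scale_def)
qed

text \<open>At time 0 the interleaving identity says that N * M is the matrix of the internal map
  from 0 to 2 * \<epsilon>, which is the identity on \<open>L\<close>. Only the intervals in
  \<open>L\<close> receive a partner, but the partner may be any interval of degree n, short ones
  included.\<close>

lemma interleaving_injection:
  fixes \<phi> :: "real \<Rightarrow> nat \<Rightarrow> ('i \<Rightarrow> 'f::field) \<Rightarrow> 'k \<Rightarrow> 'f"
  assumes I: "interleaving (pointwise_scale (*)) (pointwise_scale (*)) \<epsilon> X.isum Y.isum \<phi> \<psi>"
    and \<epsilon>: "\<epsilon> > 0" and fin: "finite {i \<in> A. deg i = n}" "finite {k \<in> A'. deg' k = n}"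
  defines "L \<equiv> {i \<in> A. deg i = n \<and> ennreal (2 * \<epsilon>) < snd (itv i)}"
  shows "\<exists>f. inj_on f L \<and>
    (\<forall>i\<in>L. f i \<in> {k \<in> A'. deg' k = n} \<and> pair_cost (itv i) (itv' (f i)) \<le> ennreal \<epsilon>)"
proof -
  let ?S = "{i \<in> A. deg i = n}" and ?S' = "{k \<in> A'. deg' k = n}"
  define T where "T = (fst \<circ> itv) ` ?S \<union> (snd \<circ> itv) ` ?S \<union> (fst \<circ> itv') ` ?S' \<union> (snd \<circ> itv') ` ?S'"
  have "finite T" using fin by (simp add: T_def)
  then obtain h where h: "\<And>x y. x \<in> T \<Longrightarrow> y \<in> T \<Longrightarrow> h x \<le> h y + \<epsilon> \<longleftrightarrow> x \<le> y + ennreal \<epsilon>"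
    using ennreal_truncation[of T \<epsilon>] \<epsilon> by auto
  have T: "fst (itv i) \<in> T" "snd (itv i) \<in> T" if "i \<in> ?S" for i
    using that by (auto simp: T_def)
  have T': "fst (itv' i) \<in> T" "snd (itv' i) \<in> T" if "i \<in> ?S'" for i
    using that by (auto simp: T_def)
  have \<phi>: "pmorphism (pointwise_scale (*)) (pointwise_scale (*)) X.isum (shift_pcplx \<epsilon> Y.isum) \<phi>"
    and \<psi>: "pmorphism (pointwise_scale (*)) (pointwise_scale (*)) Y.isum (shift_pcplx \<epsilon> X.isum) \<psi>"
    and \<psi>\<phi>: "\<And>x i. x \<in> ob (val X.isum 0) i \<Longrightarrow> \<psi> \<epsilon> i (\<phi> 0 i x) = tr X.isum 0 (2 * \<epsilon>) i x"
    using I unfolding interleaving_def by (blast, blast, force)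
  interpret swap: two_interval_families A' deg' itv' A deg itv by unfold_locales
  have L: "L \<subseteq> ?S" by (auto simp: L_def)
  have "\<exists>f. inj_on f L \<and> (\<forall>i\<in>L. f i \<in> ?S' \<and>
      \<bar>h (fst (itv i)) - h (fst (itv' (f i)))\<bar> \<le> \<epsilon> \<and> \<bar>h (snd (itv i)) - h (snd (itv' (f i)))\<bar> \<le> \<epsilon>)"
  proof (rule matching_of_matrices[where N = "\<lambda>i k. \<psi> 0 n (Y.gen k) i" and M = "\<lambda>k j. \<phi> 0 n (X.gen j) k"])
    show "finite L" using finite_subset[OF L fin(1)] .
    show "finite ?S'" by (rule fin(2))
  next
    fix k j assume "k \<in> ?S'" "j \<in> L" "\<phi> 0 n (X.gen j) k \<noteq> 0"
    then show "h (fst (itv' k)) \<le> h (fst (itv j)) + \<epsilon> \<and> h (snd (itv' k)) \<le> h (snd (itv j)) + \<epsilon>"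
      using morphism_entry[OF \<phi> \<epsilon>, of j n k] L T[of j] T'[of k] by (auto simp: h)
  next
    fix i k assume "k \<in> ?S'" "i \<in> L" "\<psi> 0 n (Y.gen k) i \<noteq> 0"
    then show "h (fst (itv i)) \<le> h (fst (itv' k)) + \<epsilon> \<and> h (snd (itv i)) \<le> h (snd (itv' k)) + \<epsilon>"
      using swap.morphism_entry[OF \<psi> \<epsilon>, of k n i] L T[of i] T'[of k] by (auto simp: h)
  next
    fix i j assume i: "i \<in> L" and j: "j \<in> L"
    let ?g = "X.gen j :: 'i \<Rightarrow> 'f"
    have g: "?g \<in> ob (val X.isum 0) n"
      using X.gen_in_isum[of j] X.alive_0[of j] j by (auto simp: L_def)
    have "\<phi> 0 n ?g \<in> ob (val Y.isum \<epsilon>) n"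
      using lin_mapD(1)[OF ch_mapD(1)[OF pmorphismD(1)[OF \<phi> order_refl]] g] by simp
    then have "\<psi> \<epsilon> n (\<phi> 0 n ?g) i = (\<Sum>k\<in>?S'. \<phi> 0 n ?g k * \<psi> 0 n (Y.gen k) i)"
      using morphism_coordinate[OF \<psi> \<epsilon> fin(2)] i by (auto simp: L_def)
    then show "(\<Sum>k\<in>?S'. \<psi> 0 n (Y.gen k) i * \<phi> 0 n ?g k) = (if i = j then 1 else 0)"
      using \<psi>\<phi>[OF g] X.tr_isum[OF g, of "2 * \<epsilon>"] \<epsilon> i
      by (simp add: mult.commute L_def live_def X.gen_def)
  qed
  then obtain f where f: "inj_on f L"
    "\<And>i. i \<in> L \<Longrightarrow> f i \<in> ?S' \<and> \<bar>h (fst (itv i)) - h (fst (itv' (f i)))\<bar> \<le> \<epsilon> \<and>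
      \<bar>h (snd (itv i)) - h (snd (itv' (f i)))\<bar> \<le> \<epsilon>" by blast
  have "pair_cost (itv i) (itv' (f i)) \<le> ennreal \<epsilon>" if "i \<in> L" for i
  proof -
    have i: "i \<in> ?S" "f i \<in> ?S'" using that f L by auto
    have "h (fst (itv i)) \<le> h (fst (itv' (f i))) + \<epsilon>" "h (fst (itv' (f i))) \<le> h (fst (itv i)) + \<epsilon>"
      "h (snd (itv i)) \<le> h (snd (itv' (f i))) + \<epsilon>" "h (snd (itv' (f i))) \<le> h (snd (itv i)) + \<epsilon>"
      using f(2)[OF that] by linarith+
    then show ?thesis using T[OF i(1)] T'[OF i(2)] by (simp add: pair_cost_def abs_diff_le_iff h)
  qed
  then show ?thesis using f by blast
qed

text \<open>The injections in both directions cover the long intervals of each side; merged, they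
  leave unmatched only intervals with endpoint at most 2 * \<epsilon>, that is, of weight at most
  \<epsilon>.\<close>

lemma interleaving_matching:
  fixes \<phi> :: "real \<Rightarrow> nat \<Rightarrow> ('i \<Rightarrow> 'f::field) \<Rightarrow> 'k \<Rightarrow> 'f"
  assumes I: "interleaving (pointwise_scale (*)) (pointwise_scale (*)) \<epsilon> X.isum Y.isum \<phi> \<psi>"
    and \<epsilon>: "\<epsilon> > 0" and fin: "finite {i \<in> A. deg i = n}" "finite {k \<in> A'. deg' k = n}"
  shows "\<exists>M \<subseteq> {i \<in> A. deg i = n} \<times> {k \<in> A'. deg' k = n}.
    (\<forall>(a, b)\<in>M. pair_cost (itv a) (itv' b) \<le> ennreal \<epsilon>) \<and>
    (\<forall>a\<in>{i \<in> A. deg i = n} - Domain M. snd (itv a) \<le> ennreal (2 * \<epsilon>)) \<and>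
    (\<forall>b\<in>{k \<in> A'. deg' k = n} - Range M. snd (itv' b) \<le> ennreal (2 * \<epsilon>)) \<and>
    (\<forall>a b b'. (a, b) \<in> M \<longrightarrow> (a, b') \<in> M \<longrightarrow> b = b') \<and>
    (\<forall>a a' b. (a, b) \<in> M \<longrightarrow> (a', b) \<in> M \<longrightarrow> a = a')"
proof -
  let ?S = "{i \<in> A. deg i = n}" and ?S' = "{k \<in> A'. deg' k = n}"
  let ?L = "{i \<in> A. deg i = n \<and> ennreal (2 * \<epsilon>) < snd (itv i)}"
  let ?L' = "{k \<in> A'. deg' k = n \<and> ennreal (2 * \<epsilon>) < snd (itv' k)}"
  interpret swap: two_interval_families A' deg' itv' A deg itv by unfold_locales
  obtain f where f: "inj_on f ?L"
    "\<And>i. i \<in> ?L \<Longrightarrow> f i \<in> ?S' \<and> pair_cost (itv i) (itv' (f i)) \<le> ennreal \<epsilon>"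
    using interleaving_injection[OF I \<epsilon> fin] by blast
  have "interleaving (pointwise_scale (*)) (pointwise_scale (*)) \<epsilon> Y.isum X.isum \<psi> \<phi>"
    using I interleaving_commute by blast
  then obtain g where g: "inj_on g ?L'"
    "\<And>i. i \<in> ?L' \<Longrightarrow> g i \<in> ?S \<and> pair_cost (itv' i) (itv (g i)) \<le> ennreal \<epsilon>"
    using swap.interleaving_injection[OF _ \<epsilon> fin(2,1)] by blast
  have sym: "pair_cost a b \<le> ennreal \<epsilon> \<longleftrightarrow> pair_cost b a \<le> ennreal \<epsilon>" for a b
    by (auto simp: pair_cost_def abs_diff_le_iff)
  obtain M where M: "\<forall>(a, b)\<in>M. pair_cost (itv a) (itv' b) \<le> ennreal \<epsilon>"
    "?L \<subseteq> Domain M" "?L' \<subseteq> Range M" "Domain M \<subseteq> ?L \<union> g ` ?L'" "Range M \<subseteq> ?L' \<union> f ` ?L"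
    "\<forall>a b b'. (a, b) \<in> M \<longrightarrow> (a, b') \<in> M \<longrightarrow> b = b'"
    "\<forall>a a' b. (a, b) \<in> M \<longrightarrow> (a', b) \<in> M \<longrightarrow> a = a'"
    using matching_of_injections[of f ?L "\<lambda>a b. pair_cost (itv a) (itv' b) \<le> ennreal \<epsilon>" g ?L'] f g sym
    by blast
  have "Domain M \<subseteq> ?S" "Range M \<subseteq> ?S'" using M(4,5) f(2) g(2) by blast+
  then have "M \<subseteq> ?S \<times> ?S'" by (auto simp: subset_iff)
  moreover have "snd (itv a) \<le> ennreal (2 * \<epsilon>)" if "a \<in> ?S - Domain M" for a
    using M(2) that by (auto simp: subset_iff not_less[symmetric])
  moreover have "snd (itv' b) \<le> ennreal (2 * \<epsilon>)" if "b \<in> ?S' - Range M" for b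
    using M(3) that by (auto simp: subset_iff not_less[symmetric])
  ultimately show ?thesis using M(1,6,7) by (intro exI[of _ M]) blast
qed

end

section \<open>From matchings to interleavings\<close>

lemma live_shift:
  assumes "live n J' (r + \<epsilon>) i" "0 \<le> r" "0 \<le> \<epsilon>"
    and "fst J' \<le> fst J + ennreal \<epsilon>" "snd J' \<le> snd J + ennreal \<epsilon>"
  shows "live n J r i"
proof -
  have "ennreal r < b" if "ennreal (r + \<epsilon>) < b'" "b' \<le> b + ennreal \<epsilon>" for b b' :: ennreal
  proof (rule ccontr)
    assume "\<not> ennreal r < b"
    then have "b + ennreal \<epsilon> \<le> ennreal (r + \<epsilon>)" using assms(2,3) by (simp add: not_less ennreal_plus)
    with that show False by simp
  qed
  with assms show ?thesis by (auto simp: live_def)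
qed

text \<open>Generators go to their partners, expressed by pulling coefficients back along
  \<open>R\<close>. Of the intervals only those of the target enter, so the map in the other
  direction is the same construction for the converse relation. Uniqueness of partners will make
  \<open>SOME\<close> unambiguous.\<close>

definition interval_transport ::
  "('k \<Rightarrow> nat) \<Rightarrow> ('k \<Rightarrow> tagged_interval) \<Rightarrow> ('i \<times> 'k) set \<Rightarrow> real \<Rightarrow> real \<Rightarrow> nat \<Rightarrow>
    ('i \<Rightarrow> 'f::field) \<Rightarrow> 'k \<Rightarrow> 'f" where
  "interval_transport deg itv R \<epsilon> r i h k =
    (if k \<in> Range R \<and> live (deg k) (itv k) (r + \<epsilon>) i then h (SOME j. (j, k) \<in> R) else 0)"

context two_interval_families
begin

text \<open>A matching of cost at most \<epsilon> in all degrees at once, with t / 2 \<le>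
  \<epsilon> written without division.\<close>

definition close_matching :: "real \<Rightarrow> ('i \<times> 'k) set \<Rightarrow> bool" where
  "close_matching \<epsilon> R \<longleftrightarrow> R \<subseteq> A \<times> A' \<and>
    (\<forall>(a, b)\<in>R. deg a = deg' b \<and> pair_cost (itv a) (itv' b) \<le> ennreal \<epsilon>) \<and>
    (\<forall>a\<in>A - Domain R. snd (itv a) \<le> ennreal (2 * \<epsilon>)) \<and>
    (\<forall>b\<in>A' - Range R. snd (itv' b) \<le> ennreal (2 * \<epsilon>)) \<and>
    (\<forall>a b b'. (a, b) \<in> R \<longrightarrow> (a, b') \<in> R \<longrightarrow> b = b') \<and>
    (\<forall>a a' b. (a, b) \<in> R \<longrightarrow> (a', b) \<in> R \<longrightarrow> a = a')"

abbreviation transport :: "('i \<times> 'k) set \<Rightarrow> real \<Rightarrow> real \<Rightarrow> nat \<Rightarrow> ('i \<Rightarrow> 'f::field) \<Rightarrow> 'k \<Rightarrow> 'f" where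
  "transport \<equiv> interval_transport deg' itv'"

lemma transport_eq:
  assumes "close_matching \<epsilon> R" "(j, k) \<in> R"
  shows "transport R \<epsilon> r i h k = (if Y.alive k (r + \<epsilon>) i then h j else 0)"
proof -
  have "(SOME j. (j, k) \<in> R) = j"
    using assms unfolding close_matching_def by (metis (mono_tags, lifting) someI)
  then show ?thesis using assms(2) by (auto simp: interval_transport_def)
qed

lemma transport_unmatched: "k \<notin> Range R \<Longrightarrow> transport R \<epsilon> r i h k = 0"
  by (simp add: interval_transport_def)

lemma close_matchingD:
  assumes "close_matching \<epsilon> R" "(j, k) \<in> R"
  shows "j \<in> A" "k \<in> A'" "deg j = deg' k"
    "0 \<le> r \<Longrightarrow> 0 \<le> \<epsilon> \<Longrightarrow> Y.alive k (r + \<epsilon>) i \<Longrightarrow> X.alive j r i"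
    "0 \<le> r \<Longrightarrow> 0 \<le> \<epsilon> \<Longrightarrow> X.alive j (r + \<epsilon>) i \<Longrightarrow> Y.alive k r i"
proof -
  show "j \<in> A" "k \<in> A'" and d: "deg j = deg' k" using assms unfolding close_matching_def by auto
  have "pair_cost (itv j) (itv' k) \<le> ennreal \<epsilon>" using assms unfolding close_matching_def by auto
  then have "fst (itv' k) \<le> fst (itv j) + ennreal \<epsilon>" "snd (itv' k) \<le> snd (itv j) + ennreal \<epsilon>"
    "fst (itv j) \<le> fst (itv' k) + ennreal \<epsilon>" "snd (itv j) \<le> snd (itv' k) + ennreal \<epsilon>"
    by (auto simp: pair_cost_def abs_diff_le_iff)
  then show "0 \<le> r \<Longrightarrow> 0 \<le> \<epsilon> \<Longrightarrow> Y.alive k (r + \<epsilon>) i \<Longrightarrow> X.alive j r i"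
    "0 \<le> r \<Longrightarrow> 0 \<le> \<epsilon> \<Longrightarrow> X.alive j (r + \<epsilon>) i \<Longrightarrow> Y.alive k r i"
    using d by (auto intro: live_shift)
qed

lemma transport_in:
  assumes "close_matching \<epsilon> R" "h \<in> ob (val X.isum r) i"
  shows "transport R \<epsilon> r i h \<in> ob (val Y.isum (r + \<epsilon>)) i"
proof -
  let ?S = "{k. transport R \<epsilon> r i h k \<noteq> 0}"
  have S: "k \<in> Range R \<and> Y.alive k (r + \<epsilon>) i \<and> h (SOME j. (j, k) \<in> R) \<noteq> 0" if "k \<in> ?S" for k
    using that by (auto simp: interval_transport_def split: if_splits)
  have some: "((SOME j. (j, k) \<in> R), k) \<in> R" if "k \<in> Range R" for k
    using that by (auto intro: someI)
  have un: "b = b'" if "(a, b) \<in> R" "(a, b') \<in> R" for a b b'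
    using assms(1) that unfolding close_matching_def by blast
  have "inj_on (\<lambda>k. SOME j. (j, k) \<in> R) ?S"
  proof (rule inj_onI)
    fix k k' assume k: "k \<in> ?S" "k' \<in> ?S" and eq: "(SOME j. (j, k) \<in> R) = (SOME j. (j, k') \<in> R)"
    show "k = k'" using un some[of k] some[of k'] S[OF k(1)] S[OF k(2)] unfolding eq by blast
  qed
  moreover have "(\<lambda>k. SOME j. (j, k) \<in> R) ` ?S \<subseteq> {j. h j \<noteq> 0}" using S by blast
  moreover have "finite {j. h j \<noteq> 0}" using assms(2) by (simp add: X.ob_isum)
  ultimately have "finite ?S" by (rule inj_on_finite)
  moreover have "k \<in> A'" if "k \<in> Range R" for k using that assms(1) by (auto simp: close_matching_def)
  ultimately show ?thesis using S by (simp add: Y.ob_isum)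
qed

text \<open>A target generator alive at t + \<epsilon> has a partner alive at t. So deleting dead
  coefficients in the source never removes one that survives in the target, and differentials and
  internal maps, being deletions of coefficients, commute with the transport.\<close>

lemma transport_pmorphism:
  assumes R: "close_matching \<epsilon> R" and \<epsilon>: "0 \<le> \<epsilon>"
  shows "pmorphism (pointwise_scale (*)) (pointwise_scale (*))
    (X.isum :: ('i \<Rightarrow> 'f::field) pcplx) (shift_pcplx \<epsilon> Y.isum) (transport R \<epsilon>)"
  unfolding pmorphism_def ch_map_def lin_map_def
proof (intro conjI allI impI ballI; (simp only: shift_simps)?)
  fix t i and h :: "'i \<Rightarrow> 'f" assume "0 \<le> t" "h \<in> ob (val X.isum t) i"
  then show "transport R \<epsilon> t i h \<in> ob (val Y.isum (t + \<epsilon>)) i" using transport_in[OF R] by blast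
next
  fix t i and h :: "'i \<Rightarrow> 'f" assume t: "0 \<le> t" and h: "h \<in> ob (val X.isum t) (Suc i)"
  show "transport R \<epsilon> t i (bd (val X.isum t) (Suc i) h) =
      bd (val Y.isum (t + \<epsilon>)) (Suc i) (transport R \<epsilon> t (Suc i) h)"
    unfolding Y.bd_isum[OF transport_in[OF R h]] X.bd_isum[OF h]
  proof
    fix k
    show "transport R \<epsilon> t i (\<lambda>j. if deg j = Suc i \<and> X.alive j t i then h j else 0) k =
        (if deg' k = Suc i \<and> Y.alive k (t + \<epsilon>) i then transport R \<epsilon> t (Suc i) h k else 0)"
    proof (cases "k \<in> Range R")
      case True
      then obtain j where j: "(j, k) \<in> R" by blast
      have "Y.alive k (t + \<epsilon>) i \<Longrightarrow> deg' k = Suc i \<Longrightarrow> Y.alive k (t + \<epsilon>) (Suc i)"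
        using Y.tag_le[OF close_matchingD(2)[OF R j]] by (auto simp: live_def)
      then show ?thesis
        using close_matchingD[OF R j] t \<epsilon> by (auto simp: transport_eq[OF R j])
    qed (simp add: transport_unmatched)
  qed
next
  fix s t i and h :: "'i \<Rightarrow> 'f" assume st: "0 \<le> s" "s \<le> t" and h: "h \<in> ob (val X.isum s) i"
  have st': "s + \<epsilon> \<le> t + \<epsilon>" using st by simp
  show "transport R \<epsilon> t i (tr X.isum s t i h) = tr Y.isum (s + \<epsilon>) (t + \<epsilon>) i (transport R \<epsilon> s i h)"
    unfolding Y.tr_isum[OF transport_in[OF R h] st'] X.tr_isum[OF h st(2)]
  proof
    fix k
    show "transport R \<epsilon> t i (\<lambda>j. if X.alive j t i then h j else 0) k =
        (if Y.alive k (t + \<epsilon>) i then transport R \<epsilon> s i h k else 0)"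
    proof (cases "k \<in> Range R")
      case True
      then obtain j where j: "(j, k) \<in> R" by blast
      show ?thesis
        using close_matchingD(4)[OF R j] st \<epsilon> live_mono[OF _ st']
        by (auto simp: transport_eq[OF R j])
    qed (simp add: transport_unmatched)
  qed
qed (auto simp: interval_transport_def pointwise_scale_def fun_eq_iff)

text \<open>On matched indices the round trip returns the coefficient of a generator alive at t + 2
  * \<epsilon>, because its partner is then alive at t + \<epsilon>. On unmatched ones it returns 0,
  and so does the internal map, as these intervals end by 2 * \<epsilon>.\<close>

lemma transport_transport:
  assumes R: "close_matching \<epsilon> R" and \<epsilon>: "0 \<le> \<epsilon>" and t: "0 \<le> t" and h: "h \<in> ob (val X.isum t) i"
  shows "interval_transport deg itv (R\<inverse>) \<epsilon> (t + \<epsilon>) i (transport R \<epsilon> t i h) =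
    tr X.isum t (t + 2 * \<epsilon>) i h"
proof -
  have le: "t \<le> t + 2 * \<epsilon>" using \<epsilon> by simp
  show ?thesis
    unfolding X.tr_isum[OF h le]
  proof
    fix j
    show "interval_transport deg itv (R\<inverse>) \<epsilon> (t + \<epsilon>) i (transport R \<epsilon> t i h) j =
        (if X.alive j (t + 2 * \<epsilon>) i then h j else 0)"
    proof (cases "j \<in> Domain R")
      case True
      then obtain k where k: "(j, k) \<in> R" by blast
      have eq: "t + \<epsilon> + \<epsilon> = t + 2 * \<epsilon>" by simp
      have "X.alive j (t + \<epsilon> + \<epsilon>) i \<Longrightarrow> Y.alive k (t + \<epsilon>) i"
        using close_matchingD(5)[OF R k] t \<epsilon> by simp
      moreover have "(SOME k. (k, j) \<in> R\<inverse>) = k"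
        using R k unfolding close_matching_def by (metis (mono_tags, lifting) converse_iff someI)
      ultimately show ?thesis using True
        by (simp add: interval_transport_def[of deg itv] transport_eq[OF R k] eq)
    next
      case False
      have "\<not> X.alive j (t + 2 * \<epsilon>) i" if "h j \<noteq> 0"
      proof -
        have j: "j \<in> A" using X.isum_supp[OF h that] by blast
        then have "snd (itv j) \<le> ennreal (2 * \<epsilon>)"
          using R False unfolding close_matching_def by blast
        also have "\<dots> \<le> ennreal (t + 2 * \<epsilon>)" using t by (intro ennreal_leI) simp
        finally have "snd (itv j) \<le> ennreal (t + 2 * \<epsilon>)" .
        then have "\<not> ennreal (t + 2 * \<epsilon>) < snd (itv j)" "\<not> ennreal (t + 2 * \<epsilon>) < fst (itv j)"
          using X.tag_le[OF j] by (auto simp: not_less)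
        then show ?thesis by (simp add: live_def)
      qed
      then show ?thesis using False by (auto simp: interval_transport_def[of deg itv])
    qed
  qed
qed

lemma matching_interleaving:
  assumes R: "close_matching \<epsilon> R" and \<epsilon>: "0 \<le> \<epsilon>"
  shows "\<exists>\<phi> \<psi>. interleaving (pointwise_scale (*)) (pointwise_scale (*)) \<epsilon>
    (X.isum :: ('i \<Rightarrow> 'f::field) pcplx) Y.isum \<phi> \<psi>"
proof -
  interpret swap: two_interval_families A' deg' itv' A deg itv by unfold_locales
  have sym: "pair_cost a b = pair_cost b a" for a b
    by (simp add: pair_cost_def abs_diff_def add.commute)
  have R': "swap.close_matching \<epsilon> (R\<inverse>)"
    using R unfolding close_matching_def swap.close_matching_def Domain_converse Range_converse
    by (intro conjI) (auto simp: sym)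
  have "interleaving (pointwise_scale (*)) (pointwise_scale (*)) \<epsilon>
      (X.isum :: ('i \<Rightarrow> 'f) pcplx) Y.isum (transport R \<epsilon>) (swap.transport (R\<inverse>) \<epsilon>)"
    unfolding interleaving_def
    by (intro conjI allI ballI impI transport_pmorphism[OF R \<epsilon>] swap.transport_pmorphism[OF R' \<epsilon>]
        transport_transport[OF R \<epsilon>] swap.transport_transport[OF R' \<epsilon>, unfolded converse_converse])
  then show ?thesis by blast
qed

end

section \<open>Orthogonal families in ultrametric spaces\<close>

text \<open>A copy of \<open>vector_space\<close>, since definitions in that locale are inherited by \<open>real_vector\<close>.\<close>

locale scaled_space = vector_space scale
  for scale :: "'a::field \<Rightarrow> 'b::ab_group_add \<Rightarrow> 'b"
begin

definition ultrametric_on :: "'b set \<Rightarrow> ('b \<Rightarrow> ennreal) \<Rightarrow> bool" where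
  "ultrametric_on V \<nu> \<longleftrightarrow>
    (\<forall>x\<in>V. \<forall>y\<in>V. \<nu> (x + y) \<le> max (\<nu> x) (\<nu> y)) \<and> (\<forall>c. \<forall>x\<in>V. \<nu> (scale c x) \<le> \<nu> x)"

text \<open>Non-Archimedean orthogonality: no cancellation makes a combination smaller than one of
  its terms. For death times: a combination dies only when all its terms with nonzero coefficient
  have died.\<close>

definition orthogonal_family :: "('b \<Rightarrow> ennreal) \<Rightarrow> 'j set \<Rightarrow> ('j \<Rightarrow> 'b) \<Rightarrow> bool" where
  "orthogonal_family \<nu> I f \<longleftrightarrow>
    (\<forall>c. \<forall>j\<in>I. c j \<noteq> 0 \<longrightarrow> \<nu> (f j) \<le> \<nu> (\<Sum>k\<in>I. scale (c k) (f k)))"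

lemma ultrametric_sum_le:
  assumes "ultrametric_on V \<nu>" "subspace V" "finite I" "\<And>k. k \<in> I \<Longrightarrow> f k \<in> V"
    "\<nu> 0 \<le> m" "\<And>k. k \<in> I \<Longrightarrow> \<nu> (f k) \<le> m"
  shows "\<nu> (\<Sum>k\<in>I. scale (c k) (f k)) \<le> m"
  using assms(3,4,6)
proof (induction I rule: finite_induct)
  case (insert k I)
  have "scale (c k) (f k) \<in> V" "(\<Sum>k\<in>I. scale (c k) (f k)) \<in> V"
    using insert.prems by (auto intro!: subspace_sum subspace_scale assms(2))
  then have "\<nu> (\<Sum>k\<in>insert k I. scale (c k) (f k)) \<le>
      max (\<nu> (scale (c k) (f k))) (\<nu> (\<Sum>k\<in>I. scale (c k) (f k)))"
    using insert.hyps assms(1) by (simp add: ultrametric_on_def)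
  also have "\<dots> \<le> m"
  proof (rule max.boundedI)
    have "\<nu> (scale (c k) (f k)) \<le> \<nu> (f k)"
      using assms(1) insert.prems(1) by (simp add: ultrametric_on_def)
    also have "\<dots> \<le> m" using insert.prems(2) by simp
    finally show "\<nu> (scale (c k) (f k)) \<le> m" .
  qed (use insert in simp)
  finally show ?case .
qed (use assms(5) in simp)

text \<open>After division by its coefficient of \<open>f k0\<close>, a combination falls under
  \<open>min\<close>, so it is at least as large as \<open>f k0\<close>. Subtracting the multiple of
  \<open>f k0\<close> then bounds the remaining part, to which \<open>orth\<close> applies.\<close>

lemma orthogonal_family_insert:
  fixes f :: "'j \<Rightarrow> 'b"
  assumes \<nu>: "ultrametric_on V \<nu>" and V: "subspace V" and I: "finite I" "k0 \<notin> I"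
    and f: "\<And>k. k \<in> insert k0 I \<Longrightarrow> f k \<in> V" and orth: "orthogonal_family \<nu> I f"
    and min: "\<And>c. \<nu> (f k0) \<le> \<nu> (f k0 + (\<Sum>k\<in>I. scale (c k) (f k)))"
  shows "orthogonal_family \<nu> (insert k0 I) f"
  unfolding orthogonal_family_def
proof (intro allI ballI impI)
  fix c :: "'j \<Rightarrow> 'a" and j assume j: "j \<in> insert k0 I" "c j \<noteq> 0"
  define u where "u = (\<Sum>k\<in>I. scale (c k) (f k))"
  have sum: "(\<Sum>k\<in>insert k0 I. scale (c k) (f k)) = scale (c k0) (f k0) + u"
    using I by (simp add: u_def)
  have uV: "u \<in> V" unfolding u_def using f by (auto intro!: subspace_sum subspace_scale V)
  show "\<nu> (f j) \<le> \<nu> (\<Sum>k\<in>insert k0 I. scale (c k) (f k))"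
    unfolding sum
  proof (cases "c k0 = 0")
    case True
    then show "\<nu> (f j) \<le> \<nu> (scale (c k0) (f k0) + u)"
      using j orth by (auto simp: orthogonal_family_def u_def)
  next
    case False
    let ?z = "scale (c k0) (f k0) + u"
    have z: "?z \<in> V" using uV f by (auto intro!: subspace_add subspace_scale V)
    have "f k0 + (\<Sum>k\<in>I. scale (c k / c k0) (f k)) = scale (1 / c k0) ?z"
      using False by (simp add: u_def scale_right_distrib scale_sum_right)
    then have k0: "\<nu> (f k0) \<le> \<nu> ?z"
      using min[of "\<lambda>k. c k / c k0"] \<nu> z unfolding ultrametric_on_def
      by (metis order_trans)
    show "\<nu> (f j) \<le> \<nu> ?z"
    proof (cases "j = k0")
      case False
      then have "\<nu> (f j) \<le> \<nu> u" using j orth by (auto simp: orthogonal_family_def u_def)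
      also have "u = ?z + scale (- c k0) (f k0)" by simp
      also have "\<nu> \<dots> \<le> max (\<nu> ?z) (\<nu> (scale (- c k0) (f k0)))"
        using \<nu> z subspace_scale[OF V f[OF insertI1]] unfolding ultrametric_on_def by blast
      also have "\<dots> \<le> \<nu> ?z"
        using \<nu> f k0 unfolding ultrametric_on_def by (meson insertI1 max.boundedI order_refl order_trans)
      finally show ?thesis .
    qed (use k0 in simp)
  qed
qed

text \<open>\<open>I\<close> stands for the boundaries already chosen, \<open>T\<close> for the
  differential. A new element is minimal outside the current span first for \<open>v\<close>, then
  for \<open>w\<close> after \<open>T\<close>; the first choice makes the family orthogonal in
  \<open>V\<close>, the second makes the images of the new elements orthogonal. The map \<iota>
  names new elements by indices outside \<open>I\<close>.\<close>

lemma orthogonal_extension: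
  fixes f :: "'j \<Rightarrow> 'b" and \<iota> :: "'b \<Rightarrow> 'j"
  assumes V: "subspace V" "finite B" "V \<subseteq> span B" and v: "ultrametric_on V v" "finite (v ` V)"
    and W: "subspace W" and w: "ultrametric_on W w" "finite (w ` W)"
    and T: "lin_map scale scale V W T"
    and I: "finite I" "f ` I \<subseteq> V" "orthogonal_family v I f"
    and \<iota>: "\<And>x. f (\<iota> x) = x" "\<And>x. \<iota> x \<notin> I"
  shows "\<exists>Y. finite Y \<and> Y \<subseteq> V \<and> 0 \<notin> Y \<and> V = span (f ` I \<union> Y) \<and>
    orthogonal_family v (I \<union> \<iota> ` Y) f \<and> orthogonal_family w (\<iota> ` Y) (\<lambda>j. T (f j))"
proof -
  \<comment> \<open>By the last clause, chosen elements are no larger for \<open>v\<close> than any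
    element outside the span; so adding them to a candidate does not increase
    \<open>v\<close>.\<close>
  define Inv where "Inv Y \<longleftrightarrow> Y \<subseteq> V \<and> independent Y \<and> orthogonal_family v (I \<union> \<iota> ` Y) f \<and>
    orthogonal_family w (\<iota> ` Y) (\<lambda>j. T (f j)) \<and>
    (\<forall>y\<in>Y. \<forall>x\<in>V - span (f ` I \<union> Y). v y \<le> v x)" for Y
  have bound: "finite Y \<and> card Y \<le> card B" if "Inv Y" for Y
    using independent_span_bound[OF V(2)] that V(3) unfolding Inv_def by blast
  have "Inv {}" using I(3) by (simp add: Inv_def orthogonal_family_def independent_empty)
  \<comment> \<open>Independent sets inside the span of \<open>B\<close> have bounded size, so a
    largest admissible \<open>Y\<close> exists; if it failed to span, the greedy choice would
    enlarge it.\<close>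
  then obtain Y where Y: "Inv Y" "\<And>Y'. Inv Y' \<Longrightarrow> card Y' \<le> card Y"
    using ex_has_greatest_nat[of Inv "{}" card "Suc (card B)"] bound by (auto simp: less_Suc_eq_le)
  have finY: "finite Y" using bound Y(1) by blast
  let ?E = "f ` I \<union> Y" and ?K = "I \<union> \<iota> ` Y"
  have fK: "f ` ?K = ?E" using \<iota>(1) by (auto simp: image_Un image_image)
  have EV: "?E \<subseteq> V" using I(2) Y(1) by (auto simp: Inv_def)
  then have sub: "span ?E \<subseteq> V" using span_minimal V(1) by blast
  have "span ?E = V"
  proof (rule ccontr)
    assume "span ?E \<noteq> V"
    define U where "U = V - span ?E"
    have U: "U \<noteq> {}" "U \<subseteq> V" using sub \<open>span ?E \<noteq> V\<close> by (auto simp: U_def)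
    have fv: "finite (v ` U)" using v(2) U(2) by (meson finite_subset image_mono)
    define m where "m = Min (v ` U)"
    have m: "m \<in> v ` U" "\<And>x. x \<in> U \<Longrightarrow> m \<le> v x" using fv U(1) by (auto simp: m_def)
    define U' where "U' = {x \<in> U. v x = m}"
    have TW: "T x \<in> W" if "x \<in> V" for x using T that by (auto simp: lin_map_def)
    have "(\<lambda>x. w (T x)) ` U' \<subseteq> w ` W" using TW U(2) by (auto simp: U'_def)
    then have fw: "finite ((\<lambda>x. w (T x)) ` U')" using w(2) finite_subset by blast
    have "U' \<noteq> {}" using m(1) by (auto simp: U'_def)
    then have "Min ((\<lambda>x. w (T x)) ` U') \<in> (\<lambda>x. w (T x)) ` U'" using Min_in[OF fw] by blast
    then obtain x where "x \<in> U'" "w (T x) = Min ((\<lambda>x. w (T x)) ` U')" by auto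
    then have x: "x \<in> U'" "\<And>z. z \<in> U' \<Longrightarrow> w (T x) \<le> w (T z)"
      using Min_le[OF fw] by auto
    have xU: "x \<in> U" "x \<in> V" "x \<notin> span ?E" and vx: "v x = m" using x(1) by (auto simp: U'_def U_def)
    have xY: "x \<notin> Y" using xU(3) span_base by blast
    have "x = y" if "\<iota> x = \<iota> y" for y using arg_cong[OF that, of f] \<iota>(1) by simp
    then have \<iota>x: "\<iota> x \<notin> ?K" using \<iota>(2) xY by blast
    have shift: "x + u \<in> U" if "u \<in> span ?E" for u
    proof -
      have "x + u \<in> V" using that xU sub by (intro subspace_add[OF V(1)]) auto
      moreover have "x + u \<notin> span ?E" using span_add_eq2[OF that, of x] xU(3) by blast
      ultimately show ?thesis by (simp add: U_def)
    qed
    have sumE: "(\<Sum>k\<in>?K. scale (c k) (f k)) \<in> span ?E"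
      "(\<Sum>k\<in>\<iota> ` Y. scale (c k) (f k)) \<in> span ?E" for c
      by (rule span_sum, rule span_scale, rule span_base, use fK in blast)+
    have "Inv (insert x Y)"
      unfolding Inv_def
    proof (intro conjI ballI)
      show "insert x Y \<subseteq> V" using Y(1) xU by (auto simp: Inv_def)
      show "independent (insert x Y)"
        using Y(1) xU(3) xY span_mono[of Y ?E] by (auto simp: Inv_def independent_insert)
      have "orthogonal_family v (insert (\<iota> x) ?K) f"
      proof (rule orthogonal_family_insert[OF v(1) V(1) _ \<iota>x])
        show "orthogonal_family v ?K f" using Y(1) by (simp add: Inv_def)
        show "v (f (\<iota> x)) \<le> v (f (\<iota> x) + (\<Sum>k\<in>?K. scale (c k) (f k)))" for c
          using m(2)[OF shift[OF sumE(1)]] vx \<iota>(1) by simp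
      qed (use I(1) finY EV fK xU \<iota>(1) in auto)
      then show "orthogonal_family v (I \<union> \<iota> ` insert x Y) f" by simp
      have "orthogonal_family w (insert (\<iota> x) (\<iota> ` Y)) (\<lambda>j. T (f j))"
      proof (rule orthogonal_family_insert[OF w(1) W])
        show "orthogonal_family w (\<iota> ` Y) (\<lambda>j. T (f j))" using Y(1) by (simp add: Inv_def)
      next
        fix c
        let ?u = "\<Sum>k\<in>\<iota> ` Y. scale (c k) (f k)"
        have fY: "f k \<in> V" if "k \<in> \<iota> ` Y" for k using that EV \<iota>(1) by auto
        have uV: "?u \<in> V" using sumE(2) sub by blast
        \<comment> \<open>The correction \<open>?u\<close> consists of earlier choices, each at most
          \<open>v x\<close>. Hence \<open>x + ?u\<close>, still outside the span, again has the
          minimal value \<open>m\<close> and competes with \<open>x\<close> in the second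
          minimisation.\<close>
        have "v ?u \<le> v x"
        proof (rule ultrametric_sum_le[OF v(1) V(1) _ fY])
          show "v 0 \<le> v x"
            using v(1) xU(2) unfolding ultrametric_on_def by (metis scale_zero_left)
          show "v (f k) \<le> v x" if "k \<in> \<iota> ` Y" for k
            using that Y(1) xU \<iota>(1) by (auto simp: Inv_def)
        qed (use finY in auto)
        then have "v (x + ?u) \<le> m"
          using v(1) xU(2) uV vx unfolding ultrametric_on_def by (metis max.absorb1)
        then have "x + ?u \<in> U'"
          using shift[OF sumE(2)] m(2) by (auto simp: U'_def intro: antisym)
        then have "w (T x) \<le> w (T (x + ?u))" by (rule x(2))
        also have "T (x + ?u) = T x + (\<Sum>k\<in>\<iota> ` Y. scale (c k) (T (f k)))"
          using lin_mapD(2)[OF T xU(2) uV] lin_map_sum[OF module_axioms module_axioms T V(1) fY, of "\<iota> ` Y" "\<lambda>k. k"]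
          by simp
        finally show "w (T (f (\<iota> x))) \<le> w (T (f (\<iota> x)) + (\<Sum>k\<in>\<iota> ` Y. scale (c k) (T (f k))))"
          using \<iota>(1) by simp
      qed (use finY \<iota>x EV \<iota>(1) TW xU in auto)
      then show "orthogonal_family w (\<iota> ` insert x Y) (\<lambda>j. T (f j))" by simp
    next
      fix y z assume y: "y \<in> insert x Y" and z: "z \<in> V - span (f ` I \<union> insert x Y)"
      have "z \<in> U" using z span_mono[of ?E "f ` I \<union> insert x Y"] by (auto simp: U_def)
      then show "v y \<le> v z" using y m(2) vx Y(1) by (auto simp: Inv_def U_def)
    qed
    then have "card (insert x Y) \<le> card Y" by (rule Y(2))
    then show False using xY finY by simp
  qed
  moreover have "0 \<notin> Y" using Y(1) dependent_zero by (auto simp: Inv_def)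
  ultimately show ?thesis using Y(1) finY by (intro exI[of _ Y]) (auto simp: Inv_def)
qed

lemma span_family:
  assumes "finite S" "x \<in> span (f ` S)"
  shows "\<exists>c. x = (\<Sum>j\<in>S. scale (c j) (f j))"
proof -
  let ?L = "range (\<lambda>c. \<Sum>j\<in>S. scale (c j) (f j))"
  have "subspace ?L"
  proof (rule subspaceI)
    show "0 \<in> ?L" by (rule range_eqI[of _ _ "\<lambda>_. 0"]) simp
  next
    fix a b assume "a \<in> ?L" "b \<in> ?L"
    then obtain c d where "a = (\<Sum>j\<in>S. scale (c j) (f j))" "b = (\<Sum>j\<in>S. scale (d j) (f j))" by blast
    then show "a + b \<in> ?L"
      by (intro range_eqI[of _ _ "\<lambda>j. c j + d j"]) (simp add: scale_left_distrib sum.distrib)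
  next
    fix k a assume "a \<in> ?L"
    then obtain c where "a = (\<Sum>j\<in>S. scale (c j) (f j))" by blast
    then show "scale k a \<in> ?L"
      by (intro range_eqI[of _ _ "\<lambda>j. k * c j"]) (simp add: scale_sum_right)
  qed
  moreover have "f j \<in> ?L" if "j \<in> S" for j
  proof (rule range_eqI[of _ _ "\<lambda>k. if k = j then 1 else 0"])
    have "(\<Sum>k\<in>S. scale (if k = j then 1 else 0) (f k)) = (\<Sum>k\<in>S. if k = j then f k else 0)"
      by (rule sum.cong) auto
    then show "f j = (\<Sum>k\<in>S. scale (if k = j then 1 else 0) (f k))" using assms(1) that by simp
  qed
  ultimately have "span (f ` S) \<subseteq> ?L" by (intro span_minimal) auto
  then show ?thesis using assms(2) by blast
qed

end

section \<open>Existence of tagged barcodes\<close>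

locale factored = scaled_space sc
  for sc :: "'f::field \<Rightarrow> 'a::ab_group_add \<Rightarrow> 'a" +
  fixes X :: "'a pcplx"
  assumes factored: "factored_complex sc X"
begin

abbreviation C :: "nat \<Rightarrow> 'a set" where "C \<equiv> ob (val X 0)"
abbreviation d :: "nat \<Rightarrow> 'a \<Rightarrow> 'a" where "d \<equiv> bd (val X 0)"

text \<open>A chain that never dies gets \<infinity>, the infimum of the empty set.\<close>

definition death :: "nat \<Rightarrow> 'a \<Rightarrow> ennreal" where
  "death i x = Inf {ennreal t | t. 0 \<le> t \<and> tr X 0 t i x = 0}"

lemma ch_obj_val: "0 \<le> t \<Longrightarrow> ch_obj sc (val X t)"
  using factored by (simp add: factored_complex_def parametrized_complex_def)

lemma subspace_ob: "0 \<le> t \<Longrightarrow> subspace (ob (val X t) i)"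
  using ch_obj_val[of t] by (simp add: ch_obj_def chain_complex_def)

lemma lin_bd: "0 \<le> t \<Longrightarrow> lin_map sc sc (ob (val X t) (Suc i)) (ob (val X t) i) (bd (val X t) (Suc i))"
  using ch_obj_val[of t] by (simp add: ch_obj_def chain_complex_def)

lemma bd_bd: "x \<in> C (Suc (Suc i)) \<Longrightarrow> d (Suc i) (d (Suc (Suc i)) x) = 0"
  using ch_obj_val[of 0] by (simp add: ch_obj_def chain_complex_def)

lemma ch_map_tr: "0 \<le> s \<Longrightarrow> s \<le> t \<Longrightarrow> ch_map sc sc (val X s) (val X t) (tr X s t)"
  using factored by (simp add: factored_complex_def parametrized_complex_def)

lemmas lin_tr = ch_mapD(1)[OF ch_map_tr]

lemma tr_refl: "0 \<le> t \<Longrightarrow> x \<in> ob (val X t) i \<Longrightarrow> tr X t t i x = x"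
  using factored by (simp add: factored_complex_def parametrized_complex_def)

lemma tr_tr:
  "0 \<le> r \<Longrightarrow> r \<le> s \<Longrightarrow> s \<le> t \<Longrightarrow> x \<in> ob (val X r) i \<Longrightarrow> tr X s t i (tr X r s i x) = tr X r t i x"
  using factored by (simp add: factored_complex_def parametrized_complex_def)

lemma tr_zero: "0 \<le> s \<Longrightarrow> s \<le> t \<Longrightarrow> tr X s t i 0 = 0"
  using lin_map_zero[OF module_axioms module_axioms lin_tr subspace_ob] by blast

lemma tr_surj: "0 \<le> t \<Longrightarrow> tr X 0 t i ` C i = ob (val X t) i"
  using factored by (simp add: factored_complex_def epimorphic_def ch_epi_def)

lemma iso_inj:
  assumes "ch_iso sc sc (val X s) (val X t) (tr X s t)" "0 \<le> s" "s \<le> t" "x \<in> ob (val X s) i" "tr X s t i x = 0"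
  shows "x = 0"
proof -
  obtain g where g: "\<And>i x. x \<in> ob (val X s) i \<Longrightarrow> g i (tr X s t i x) = x"
    using assms(1) unfolding ch_iso_def by blast
  have "g i 0 = 0" using g[OF subspace_0[OF subspace_ob[OF assms(2)]], of i] tr_zero[OF assms(2,3)] by simp
  then show ?thesis using g[OF assms(4)] assms(5) by simp
qed

text \<open>Tameness to the right makes the infimum attained: the internal maps from the death time
  u to slightly later times are injective, so a chain that is zero at such a time is already zero at
  u.\<close>

lemma tr_0_iff:
  assumes x: "x \<in> C i" and t: "0 \<le> t"
  shows "tr X 0 t i x = 0 \<longleftrightarrow> death i x \<le> ennreal t"
proof
  assume "tr X 0 t i x = 0"
  then show "death i x \<le> ennreal t" unfolding death_def using t by (intro Inf_lower) blast
next
  assume le: "death i x \<le> ennreal t"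
  then obtain u where u: "0 \<le> u" "death i x = ennreal u" "u \<le> t"
    using t by (cases "death i x") (auto simp: top_unique)
  obtain \<epsilon> where \<epsilon>: "\<epsilon> > 0"
    "\<And>\<delta>. 0 \<le> \<delta> \<Longrightarrow> \<delta> \<le> \<epsilon> \<Longrightarrow> ch_iso sc sc (val X u) (val X (u + \<delta>)) (tr X u (u + \<delta>))"
    using factored u(1) unfolding factored_complex_def tame_def by blast
  have "death i x < ennreal (u + \<epsilon>)" using u \<epsilon>(1) by (simp add: ennreal_less_iff)
  then obtain t' where t': "0 \<le> t'" "tr X 0 t' i x = 0" "ennreal t' < ennreal (u + \<epsilon>)"
    unfolding death_def Inf_less_iff by blast
  have "death i x \<le> ennreal t'" unfolding death_def using t' by (intro Inf_lower) blast
  then have ut: "u \<le> t'" using u t'(1) by simp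
  have lt: "t' \<le> u + \<epsilon>" using t'(1,3) by (simp add: ennreal_less_iff del: ennreal_plus)
  have xu: "tr X 0 u i x \<in> ob (val X u) i" using lin_mapD(1)[OF lin_tr[OF order_refl u(1)] x] .
  have "tr X u t' i (tr X 0 u i x) = 0" using tr_tr[OF order_refl u(1) ut x] t'(2) by simp
  moreover have "ch_iso sc sc (val X u) (val X t') (tr X u t')"
    using \<epsilon>(2)[of "t' - u"] ut lt by simp
  ultimately have "tr X 0 u i x = 0" using iso_inj[OF _ u(1) ut xu] by blast
  then show "tr X 0 t i x = 0"
    using tr_tr[OF order_refl u(1,3) x] tr_zero[OF u(1,3)] by simp
qed

lemma death_eq_0: "x \<in> C i \<Longrightarrow> death i x = 0 \<longleftrightarrow> x = 0"
  using tr_0_iff[of x i 0] tr_refl[of 0 x i] by simp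

lemma death_leI:
  assumes "x \<in> C i" "y \<in> C j" "\<And>t. 0 \<le> t \<Longrightarrow> tr X 0 t j y = 0 \<Longrightarrow> tr X 0 t i x = 0"
  shows "death i x \<le> death j y"
proof (cases "death j y")
  case (real t)
  then show ?thesis using tr_0_iff[OF assms(2), of t] tr_0_iff[OF assms(1), of t] assms(3)[of t] by simp
qed simp

lemma ultrametric_death: "ultrametric_on (C i) (death i)"
  unfolding ultrametric_on_def
proof (intro conjI ballI allI)
  fix x y assume xy: "x \<in> C i" "y \<in> C i"
  have xyC: "x + y \<in> C i" using xy subspace_ob by (intro subspace_add) auto
  show "death i (x + y) \<le> max (death i x) (death i y)"
  proof (cases "max (death i x) (death i y)")
    case (real t)
    then have "death i x \<le> ennreal t" "death i y \<le> ennreal t" by (metis max.cobounded1 max.cobounded2)+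
    then have "tr X 0 t i x = 0" "tr X 0 t i y = 0" using tr_0_iff xy real(1) by auto
    then have "tr X 0 t i (x + y) = 0"
      using lin_mapD(2)[OF lin_tr[OF order_refl real(1)] xy] by simp
    then show ?thesis using tr_0_iff[OF xyC real(1)] real(2) by simp
  qed simp
next
  fix c x assume x: "x \<in> C i"
  show "death i (sc c x) \<le> death i x"
  proof (rule death_leI)
    show "sc c x \<in> C i" using x subspace_ob by (intro subspace_scale) auto
    show "tr X 0 t i (sc c x) = 0" if "0 \<le> t" "tr X 0 t i x = 0" for t
      using lin_mapD(3)[OF lin_tr[OF order_refl that(1)] x] that(2) by simp
  qed (rule x)
qed

lemma d_in: "x \<in> C (Suc i) \<Longrightarrow> d (Suc i) x \<in> C i"
  using lin_mapD(1)[OF lin_bd[of 0]] by simp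

lemma death_d:
  assumes x: "x \<in> C (Suc i)"
  shows "death i (d (Suc i) x) \<le> death (Suc i) x"
proof (rule death_leI)
  fix t :: real assume t: "0 \<le> t" and tx: "tr X 0 t (Suc i) x = 0"
  have "tr X 0 t i (d (Suc i) x) = bd (val X t) (Suc i) (tr X 0 t (Suc i) x)"
    using ch_mapD(2)[OF ch_map_tr[OF order_refl t] x] .
  also have "\<dots> = 0"
    using lin_map_zero[OF module_axioms module_axioms lin_bd[OF t] subspace_ob[OF t]] tx by simp
  finally show "tr X 0 t i (d (Suc i) x) = 0" .
qed (use d_in x in auto)

text \<open>If the maps into a time u > 0 from slightly earlier times are isomorphisms, a chain dead
  at u died before u. So death times are 0, \<infinity> or one of the finitely many exceptional
  times of tameness, and the minima in the greedy choice exist.\<close>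

lemma finite_death: "finite (death i ` C i)"
proof -
  define S where "S = {t. t > 0 \<and> \<not> (\<exists>\<epsilon>>0. \<epsilon> \<le> t \<and> (\<forall>\<delta>. 0 \<le> \<delta> \<longrightarrow> \<delta> \<le> \<epsilon> \<longrightarrow>
      ch_iso sc sc (val X (t - \<delta>)) (val X t) (tr X (t - \<delta>) t)))}"
  have "finite S" using factored unfolding factored_complex_def tame_def S_def by blast
  moreover have "death i x \<in> {0, \<infinity>} \<union> ennreal ` S" if x: "x \<in> C i" for x
  proof (rule ccontr)
    assume *: "death i x \<notin> {0, \<infinity>} \<union> ennreal ` S"
    then obtain u where u: "0 \<le> u" "death i x = ennreal u" by (cases "death i x") auto
    then have "u > 0" "u \<notin> S" using * by (auto simp: less_le)
    then obtain \<epsilon> where \<epsilon>: "\<epsilon> > 0" "\<epsilon> \<le> u" "ch_iso sc sc (val X (u - \<epsilon>)) (val X u) (tr X (u - \<epsilon>) u)"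
      unfolding S_def by (auto dest: spec[of _ "_::real"])
    have ge: "0 \<le> u - \<epsilon>" "u - \<epsilon> \<le> u" using \<epsilon> by auto
    have "tr X (u - \<epsilon>) u i (tr X 0 (u - \<epsilon>) i x) = 0"
      using tr_tr[OF order_refl ge x] tr_0_iff[OF x u(1)] u(2) by simp
    then have "tr X 0 (u - \<epsilon>) i x = 0"
      using iso_inj[OF \<epsilon>(3) ge] lin_mapD(1)[OF lin_tr[OF order_refl ge(1)] x] by blast
    then have "ennreal u \<le> ennreal (u - \<epsilon>)" using tr_0_iff[OF x ge(1)] u(2) by simp
    then show False using \<epsilon> ge by simp
  qed
  then have "death i ` C i \<subseteq> {0, \<infinity>} \<union> ennreal ` S" by blast
  ultimately show ?thesis by (meson finite.emptyI finite_Un finite_imageI finite_insert finite_subset)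
qed

section \<open>Bases adapted to boundaries and death times\<close>

lemma finite_span: "\<exists>B. finite B \<and> C i \<subseteq> span B"
  using ch_obj_val[of 0] unfolding ch_obj_def compact_complex_def by (metis order_refl)

lemma finite_degrees: "finite {i. C i \<noteq> {0}}"
  using ch_obj_val[of 0] unfolding ch_obj_def compact_complex_def by simp

text \<open>An index is a degree with a chosen chain x of that degree. In degree i it stands for x
  if x has degree i, and for the boundary of x if x has degree i + 1. A cycle keeps its index in the
  lower degree, with value 0.\<close>

definition elt :: "nat \<Rightarrow> nat \<times> 'a \<Rightarrow> 'a" where
  "elt i j = (if fst j = i then snd j else d (Suc i) (snd j))"

text \<open>
  The boundaries of the chosen elements in degree \<open>i + 1\<close> are extended by those in degree \<open>i\<close> to an
  orthogonal spanning family of \<open>C i\<close>.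
\<close>

definition adapted :: "nat \<Rightarrow> 'a set \<Rightarrow> 'a set \<Rightarrow> bool" where
  "adapted i Z Y \<longleftrightarrow> finite Y \<and> Y \<subseteq> C i \<and> 0 \<notin> Y \<and>
    C i = span (elt i ` ({Suc i} \<times> Z \<union> {i} \<times> Y)) \<and>
    orthogonal_family (death i) ({Suc i} \<times> Z \<union> {i} \<times> Y) (elt i) \<and>
    (\<forall>k. i = Suc k \<longrightarrow> orthogonal_family (death k) ({i} \<times> Y) (elt k))"

lemma orthogonal_family_cong:
  "(\<And>j. j \<in> I \<Longrightarrow> f j = g j) \<Longrightarrow> orthogonal_family \<nu> I f = orthogonal_family \<nu> I g"
  unfolding orthogonal_family_def by (simp cong: sum.cong)

lemma adapted_exists:
  assumes Z: "finite Z" "Z \<subseteq> C (Suc i)" "orthogonal_family (death i) ({Suc i} \<times> Z) (elt i)"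
  shows "\<exists>Y. adapted i Z Y"
proof -
  obtain B where B: "finite B" "C i \<subseteq> span B" using finite_span by blast
  obtain T w W where T: "subspace W" "ultrametric_on W w" "finite (w ` W)" "lin_map sc sc (C i) W T"
    and Tk: "\<And>k. i = Suc k \<Longrightarrow> T = d i \<and> w = death k"
  proof (cases i)
    \<comment> \<open>In degree 0 there is no differential; the zero map with the zero ultrametric
      makes the second criterion void.\<close>
    case 0
    show ?thesis
      by (rule that[of "{0}" "\<lambda>_. 0" "\<lambda>_. 0"]) (auto simp: 0 ultrametric_on_def lin_map_def)
  next
    case (Suc k)
    show ?thesis
      by (rule that[of "C k" "death k" "d i"])
        (use subspace_ob ultrametric_death finite_death lin_bd[of 0] Suc in auto)
  qed
  let ?I = "{Suc i} \<times> Z"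
  have img: "elt i ` ?I \<subseteq> C i" using Z(2) d_in by (auto simp: elt_def)
  have "\<exists>Y. finite Y \<and> Y \<subseteq> C i \<and> 0 \<notin> Y \<and> C i = span (elt i ` ?I \<union> Y) \<and>
      orthogonal_family (death i) (?I \<union> Pair i ` Y) (elt i) \<and>
      orthogonal_family w (Pair i ` Y) (\<lambda>j. T (elt i j))"
    using Z
    by (intro orthogonal_extension[OF subspace_ob B ultrametric_death finite_death T(1-4) _ img])
      (auto simp: elt_def)
  then obtain Y where Y: "finite Y" "Y \<subseteq> C i" "0 \<notin> Y" "C i = span (elt i ` ?I \<union> Y)"
      "orthogonal_family (death i) (?I \<union> Pair i ` Y) (elt i)"
      "orthogonal_family w (Pair i ` Y) (\<lambda>j. T (elt i j))" by blast
  have PY: "Pair i ` Y = {i} \<times> Y" by auto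
  have "elt i ` ({i} \<times> Y) = Y" by (force simp: elt_def)
  then have "C i = span (elt i ` (?I \<union> {i} \<times> Y))" using Y(4) by (simp add: image_Un)
  moreover have "orthogonal_family (death k) ({i} \<times> Y) (elt k)" if "i = Suc k" for k
  proof -
    have "T (elt i j) = elt k j" if "j \<in> {i} \<times> Y" for j
      using that Tk[OF \<open>i = Suc k\<close>] \<open>i = Suc k\<close> by (auto simp: elt_def)
    then show ?thesis
      using Y(6) Tk[OF that] orthogonal_family_cong[of "{i} \<times> Y" "\<lambda>j. T (elt i j)" "elt k" "death k"]
      unfolding PY by simp
  qed
  ultimately have "adapted i Z Y" using Y unfolding adapted_def PY by blast
  then show ?thesis by blast
qed

text \<open>The choice in degree i presupposes the one in degree i + 1, so the recursion runs
  downwards from a degree from which on the complex vanishes.\<close>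

lemma adapted_family: "\<exists>Y. \<forall>i. adapted i (Y (Suc i)) (Y i)"
proof -
  obtain N where "\<forall>i\<in>{i. C i \<noteq> {0}}. i < N" using finite_degrees finite_nat_set_iff_bounded by blast
  then have N: "C i = {0}" if "i \<ge> N" for i using that by force
  have "\<exists>Y. \<forall>i\<ge>N - m. adapted i (Y (Suc i)) (Y i)" for m
  proof (induction m)
    case 0
    have "adapted i {} {}" if "i \<ge> N" for i
      using N[OF that] by (simp add: adapted_def orthogonal_family_def)
    then show ?case by (intro exI[of _ "\<lambda>_. {}"]) auto
  next
    case (Suc m)
    then obtain Y where Y: "\<forall>i\<ge>N - m. adapted i (Y (Suc i)) (Y i)" by blast
    show ?case
    proof (cases "N - m = 0")
      case True
      then show ?thesis using Y by auto
    next
      case False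
      then obtain k where k: "N - m = Suc k" "N - Suc m = k" by (cases "N - m") auto
      have "adapted (Suc k) (Y (Suc (Suc k))) (Y (Suc k))" using Y k by simp
      then obtain Z where Z: "adapted k (Y (Suc k)) Z"
        using adapted_exists[of "Y (Suc k)" k] unfolding adapted_def by blast
      \<comment> \<open>Changing \<open>Y\<close> at \<open>k\<close> affects only the conditions
        for \<open>k\<close> and \<open>k - 1\<close>, and the latter is not yet claimed.\<close>
      have "adapted i ((Y(k := Z)) (Suc i)) ((Y(k := Z)) i)" if "i \<ge> k" for i
        using that Z Y k by (cases "i = k") auto
      then show ?thesis using k(2) by (intro exI[of _ "Y(k := Z)"]) auto
    qed
  qed
  from this[of N] show ?thesis by auto
qed

end

section \<open>Interval decomposition from an adapted basis\<close>

locale adapted_factored = factored sc X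
  for sc :: "'f::field \<Rightarrow> 'a::ab_group_add \<Rightarrow> 'a" and X +
  fixes Y :: "nat \<Rightarrow> 'a set"
  assumes adapted: "adapted i (Y (Suc i)) (Y i)"
begin

definition itv :: "nat \<times> 'a \<Rightarrow> tagged_interval" where
  "itv j = (case fst j of 0 \<Rightarrow> 0 | Suc k \<Rightarrow> death k (d (Suc k) (snd j)), death (fst j) (snd j))"

lemma Y_in: "y \<in> Y i \<Longrightarrow> y \<in> C i" and Y_finite: "finite (Y i)"
  using adapted[of i] by (auto simp: adapted_def)

sublocale F: interval_family "Sigma UNIV Y" fst itv
proof
  fix j assume j: "j \<in> Sigma UNIV Y"
  have "snd j \<noteq> 0" using j adapted[of "fst j"] by (auto simp: adapted_def)
  then show "0 < snd (itv j)"
    using j Y_in death_eq_0[of "snd j" "fst j"] by (auto simp: itv_def zero_less_iff_neq_zero)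
  show "fst (itv j) \<le> snd (itv j)"
    using j death_d Y_in by (auto simp: itv_def split: nat.splits)
  show "fst j = 0 \<Longrightarrow> fst (itv j) = 0" by (simp add: itv_def)
qed

definition idx :: "nat \<Rightarrow> (nat \<times> 'a) set" where
  "idx i = {Suc i} \<times> Y (Suc i) \<union> {i} \<times> Y i"

lemma finite_idx: "finite (idx i)"
  by (simp add: idx_def Y_finite)

lemma elt_in: "j \<in> idx i \<Longrightarrow> elt i j \<in> C i"
  using d_in Y_in by (auto simp: idx_def elt_def)

lemma tr_elt:
  assumes "j \<in> idx i" "0 \<le> r"
  shows "tr X 0 r i (elt i j) = 0 \<longleftrightarrow> \<not> F.alive j r i"
  using assms(1) unfolding tr_0_iff[OF elt_in[OF assms(1)] assms(2)]
  by (auto simp: idx_def elt_def live_def itv_def not_less)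

lemma isum_idx: "h \<in> ob (val F.isum r) i \<Longrightarrow> h j \<noteq> 0 \<Longrightarrow> j \<in> idx i"
  using F.isum_supp[of h r i j] by (auto simp: idx_def live_def)

text \<open>The candidate for the isomorphism from the interval sum to \<open>X\<close>: the
  coefficients are applied to the basis elements transported to time r.\<close>

definition synth :: "real \<Rightarrow> nat \<Rightarrow> (nat \<times> 'a \<Rightarrow> 'f) \<Rightarrow> 'a" where
  "synth r i h = (\<Sum>j\<in>idx i. sc (h j) (tr X 0 r i (elt i j)))"

lemma synth_eq: "0 \<le> r \<Longrightarrow> synth r i h = tr X 0 r i (\<Sum>j\<in>idx i. sc (h j) (elt i j))"
  unfolding synth_def
  by (rule lin_map_sum[symmetric, OF module_axioms module_axioms lin_tr subspace_ob]) (auto simp: elt_in)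

lemma sum_elt_in: "(\<Sum>j\<in>idx i. sc (c j) (elt i j)) \<in> C i"
  using elt_in subspace_ob by (auto intro!: subspace_sum subspace_scale)

lemma synth_pmorphism: "pmorphism (pointwise_scale (*)) sc F.isum X synth"
  unfolding pmorphism_def ch_map_def lin_map_def
proof (intro conjI allI impI ballI)
  fix t i and h :: "nat \<times> 'a \<Rightarrow> 'f" assume t: "0 \<le> t" "h \<in> ob (val F.isum t) i"
  show "synth t i h \<in> ob (val X t) i"
    unfolding synth_eq[OF t(1)] using lin_mapD(1)[OF lin_tr[OF order_refl t(1)] sum_elt_in] .
next
  fix t i and h :: "nat \<times> 'a \<Rightarrow> 'f" assume t: "0 \<le> t" and h: "h \<in> ob (val F.isum t) (Suc i)"
  have "synth t i (bd (val F.isum t) (Suc i) h) =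
      (\<Sum>j\<in>idx i. if fst j = Suc i then sc (h j) (tr X 0 t i (elt i j)) else 0)"
    unfolding synth_def F.bd_isum[OF h]
  proof (rule sum.cong)
    fix j assume j: "j \<in> idx i"
    show "sc (if fst j = Suc i \<and> F.alive j t i then h j else 0) (tr X 0 t i (elt i j)) =
        (if fst j = Suc i then sc (h j) (tr X 0 t i (elt i j)) else 0)"
      using tr_elt[OF j t] by auto
  qed simp
  also have "\<dots> = (\<Sum>j\<in>{Suc i} \<times> Y (Suc i). sc (h j) (tr X 0 t i (elt i j)))"
    using finite_idx by (intro sum.mono_neutral_cong_right) (auto simp: idx_def)
  also have "\<dots> = (\<Sum>j\<in>{Suc i} \<times> Y (Suc i). sc (h j) (bd (val X t) (Suc i) (tr X 0 t (Suc i) (elt (Suc i) j))))"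
    using ch_mapD(2)[OF ch_map_tr[OF order_refl t]] Y_in by (intro sum.cong) (auto simp: elt_def)
  \<comment> \<open>The added indices belong to chains of degree i + 2; they contribute boundaries
    in degree i + 1, whose differentials vanish.\<close>
  also have "\<dots> = (\<Sum>j\<in>idx (Suc i). sc (h j) (bd (val X t) (Suc i) (tr X 0 t (Suc i) (elt (Suc i) j))))"
  proof (intro sum.mono_neutral_left finite_idx)
    show "\<forall>j\<in>idx (Suc i) - {Suc i} \<times> Y (Suc i).
        sc (h j) (bd (val X t) (Suc i) (tr X 0 t (Suc i) (elt (Suc i) j))) = 0"
    proof
      fix j assume "j \<in> idx (Suc i) - {Suc i} \<times> Y (Suc i)"
      then obtain y where y: "j = (Suc (Suc i), y)" "y \<in> Y (Suc (Suc i))" by (auto simp: idx_def)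
      then have "bd (val X t) (Suc i) (tr X 0 t (Suc i) (elt (Suc i) j)) = tr X 0 t i 0"
        using ch_mapD(2)[OF ch_map_tr[OF order_refl t], of "elt (Suc i) j" i] bd_bd[of y i] Y_in d_in
        by (auto simp: elt_def)
      then show "sc (h j) (bd (val X t) (Suc i) (tr X 0 t (Suc i) (elt (Suc i) j))) = 0"
        using tr_zero[OF order_refl t] by simp
    qed
  qed (auto simp: idx_def)
  also have "\<dots> = bd (val X t) (Suc i) (synth t (Suc i) h)"
    unfolding synth_def
    by (rule lin_map_sum[symmetric, OF module_axioms module_axioms lin_bd[OF t] subspace_ob[OF t]])
      (use lin_mapD(1)[OF lin_tr[OF order_refl t]] elt_in in blast)
  finally show "synth t i (bd (val F.isum t) (Suc i) h) = bd (val X t) (Suc i) (synth t (Suc i) h)" .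
next
  fix s t i and h :: "nat \<times> 'a \<Rightarrow> 'f" assume st: "0 \<le> s" "s \<le> t" and h: "h \<in> ob (val F.isum s) i"
  have t: "0 \<le> t" using st by simp
  have "synth t i (tr F.isum s t i h) = synth t i h"
    unfolding synth_def F.tr_isum[OF h st(2)]
  proof (rule sum.cong)
    fix j assume j: "j \<in> idx i"
    show "sc (if F.alive j t i then h j else 0) (tr X 0 t i (elt i j)) =
        sc (h j) (tr X 0 t i (elt i j))"
      using tr_elt[OF j t] by auto
  qed simp
  also have "\<dots> = tr X s t i (synth s i h)"
    unfolding synth_eq[OF st(1)] synth_eq[OF t] using tr_tr[OF order_refl st sum_elt_in] by simp
  finally show "synth t i (tr F.isum s t i h) = tr X s t i (synth s i h)" .
qed (auto simp: synth_def pointwise_scale_def scale_left_distrib sum.distrib scale_sum_right)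

text \<open>Injectivity is orthogonality: if a combination is zero at r, all its terms are dead at
  r. Surjectivity holds because the basis spans at time 0 and internal maps are
  epimorphisms.\<close>

lemma synth_bij:
  assumes r: "0 \<le> r"
  shows "bij_betw (synth r i) (ob (val F.isum r) i) (ob (val X r) i)"
proof (rule bij_betw_imageI)
  have zero: "h = 0" if h: "h \<in> ob (val F.isum r) i" "synth r i h = 0" for h
  proof (rule ccontr)
    assume "h \<noteq> 0"
    then obtain j where j: "h j \<noteq> 0" by (auto simp: fun_eq_iff)
    then have ji: "j \<in> idx i" using isum_idx[OF h(1)] by blast
    have "death i (elt i j) \<le> death i (\<Sum>j\<in>idx i. sc (h j) (elt i j))"
      using adapted[of i] j ji unfolding adapted_def orthogonal_family_def idx_def by blast
    also have "\<dots> \<le> ennreal r"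
      using h(2) unfolding synth_eq[OF r] tr_0_iff[OF sum_elt_in r] .
    finally have "\<not> F.alive j r i" using tr_elt[OF ji r] tr_0_iff[OF elt_in[OF ji] r] by blast
    then show False using F.isum_supp[OF h(1) j] by blast
  qed
  interpret P: vector_space "pointwise_scale (*) :: 'f \<Rightarrow> (nat \<times> 'a \<Rightarrow> 'f) \<Rightarrow> _"
    by (rule vector_space_pointwise_scale)
  show "inj_on (synth r i) (ob (val F.isum r) i)"
  proof (rule inj_onI)
    fix g h assume gh: "g \<in> ob (val F.isum r) i" "h \<in> ob (val F.isum r) i" "synth r i g = synth r i h"
    have "synth r i (g - h) = 0"
      using gh(3) by (simp add: synth_def scale_left_diff_distrib sum_subtractf)
    then show "g = h" using zero[OF P.subspace_diff[OF F.subspace_isum gh(1,2)]] by simp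
  qed
  show "synth r i ` ob (val F.isum r) i = ob (val X r) i"
  proof
    show "synth r i ` ob (val F.isum r) i \<subseteq> ob (val X r) i"
      using synth_eq[OF r] lin_mapD(1)[OF lin_tr[OF order_refl r] sum_elt_in] by auto
    show "ob (val X r) i \<subseteq> synth r i ` ob (val F.isum r) i"
    proof
      fix x assume "x \<in> ob (val X r) i"
      then obtain z where z: "z \<in> C i" "x = tr X 0 r i z" using tr_surj[OF r] by blast
      then have "z \<in> span (elt i ` idx i)"
        using adapted[of i] unfolding adapted_def idx_def by blast
      then obtain c where c: "z = (\<Sum>j\<in>idx i. sc (c j) (elt i j))"
        using span_family[OF finite_idx] by blast
      \<comment> \<open>Coefficients of generators dead at r are dropped to obtain a chain of the
        interval sum; the corresponding transported elements are zero.\<close>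
      define h where "h j = (if j \<in> idx i \<and> F.alive j r i then c j else 0)" for j
      have "finite {j. h j \<noteq> 0}" using finite_idx[of i] by (rule rev_finite_subset) (auto simp: h_def)
      then have "h \<in> ob (val F.isum r) i"
        by (auto simp: F.ob_isum h_def idx_def split: if_splits)
      moreover have "synth r i h = synth r i c"
        unfolding synth_def by (intro sum.cong) (use tr_elt r in \<open>auto simp: h_def\<close>)
      ultimately show "x \<in> synth r i ` ob (val F.isum r) i" using z c synth_eq[OF r, of i c] by (intro image_eqI[of _ _ h]) simp_all
    qed
  qed
qed

end

section \<open>Isomorphisms and interleavings\<close>

lemma pmorphism_compose:
  assumes "pmorphism a b X Y \<phi>" "pmorphism b c Y Z \<psi>"
  shows "pmorphism a c X Z (\<lambda>t i x. \<psi> t i (\<phi> t i x))"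
  using assms unfolding pmorphism_def ch_map_def lin_map_def by (clarsimp; metis)

lemma pmorphism_shift:
  assumes "pmorphism a b X Y \<phi>" "0 \<le> \<epsilon>"
  shows "pmorphism a b (shift_pcplx \<epsilon> X) (shift_pcplx \<epsilon> Y) (\<lambda>t. \<phi> (t + \<epsilon>))"
  using assms unfolding pmorphism_def by simp

lemma shift_0: "shift_pcplx 0 X = X"
  by (simp add: shift_pcplx_def)

lemma pisomorphic_sym: "pisomorphic a b X Y \<Longrightarrow> pisomorphic b a Y X"
  unfolding pisomorphic_def by blast

lemma pmorphism_in:
  "pmorphism a b X Y \<phi> \<Longrightarrow> 0 \<le> t \<Longrightarrow> x \<in> ob (val X t) i \<Longrightarrow> \<phi> t i x \<in> ob (val Y t) i"
  by (rule lin_mapD(1)[OF ch_mapD(1)[OF pmorphismD(1)]])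

lemma pisomorphic_trans:
  assumes "pisomorphic a b X Y" "pisomorphic b c Y Z"
  shows "pisomorphic a c X Z"
proof -
  obtain \<alpha> \<alpha>' where \<alpha>: "pmorphism a b X Y \<alpha>" "pmorphism b a Y X \<alpha>'"
    "\<And>t i x. 0 \<le> t \<Longrightarrow> x \<in> ob (val X t) i \<Longrightarrow> \<alpha>' t i (\<alpha> t i x) = x"
    "\<And>t i y. 0 \<le> t \<Longrightarrow> y \<in> ob (val Y t) i \<Longrightarrow> \<alpha> t i (\<alpha>' t i y) = y"
    using assms(1) unfolding pisomorphic_def by blast
  obtain \<beta> \<beta>' where \<beta>: "pmorphism b c Y Z \<beta>" "pmorphism c b Z Y \<beta>'"
    "\<And>t i x. 0 \<le> t \<Longrightarrow> x \<in> ob (val Y t) i \<Longrightarrow> \<beta>' t i (\<beta> t i x) = x"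
    "\<And>t i y. 0 \<le> t \<Longrightarrow> y \<in> ob (val Z t) i \<Longrightarrow> \<beta> t i (\<beta>' t i y) = y"
    using assms(2) unfolding pisomorphic_def by blast
  show ?thesis
    unfolding pisomorphic_def
    by (intro exI conjI, rule pmorphism_compose[OF \<alpha>(1) \<beta>(1)], rule pmorphism_compose[OF \<beta>(2) \<alpha>(2)])
      (simp_all add: \<alpha>(3,4) \<beta>(3,4) pmorphism_in[OF \<alpha>(1)] pmorphism_in[OF \<beta>(2)])
qed

text \<open>The pointwise inverse inherits linearity and naturality, since each identity can be
  checked after applying the injective maps \<open>\<phi> t i\<close>.\<close>

lemma pisomorphic_of_bij:
  assumes \<phi>: "pmorphism sc sc' X Y \<phi>" and m: "module sc"
    and sub: "\<And>t i. 0 \<le> t \<Longrightarrow> module.subspace sc (ob (val X t) i)"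
    and bd: "\<And>t i x. 0 \<le> t \<Longrightarrow> x \<in> ob (val X t) (Suc i) \<Longrightarrow> bd (val X t) (Suc i) x \<in> ob (val X t) i"
    and tr: "\<And>s t i x. 0 \<le> s \<Longrightarrow> s \<le> t \<Longrightarrow> x \<in> ob (val X s) i \<Longrightarrow> tr X s t i x \<in> ob (val X t) i"
    and bij: "\<And>t i. 0 \<le> t \<Longrightarrow> bij_betw (\<phi> t i) (ob (val X t) i) (ob (val Y t) i)"
  shows "pisomorphic sc sc' X Y"
proof -
  interpret module sc by (rule m)
  define \<psi> where "\<psi> t i = inv_into (ob (val X t) i) (\<phi> t i)" for t i
  have \<psi>_in: "\<psi> t i y \<in> ob (val X t) i" and \<phi>\<psi>: "\<phi> t i (\<psi> t i y) = y"
    if "0 \<le> t" "y \<in> ob (val Y t) i" for t i y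
    using that bij[OF that(1), of i] unfolding \<psi>_def bij_betw_def
    by (auto intro: inv_into_into f_inv_into_f)
  have \<psi>\<phi>: "\<psi> t i (\<phi> t i x) = x" if "0 \<le> t" "x \<in> ob (val X t) i" for t i x
    using that bij[OF that(1), of i] unfolding \<psi>_def bij_betw_def by (simp add: inv_into_f_f)
  have eqI: "\<psi> t i y = x" if "0 \<le> t" "x \<in> ob (val X t) i" "\<phi> t i x = y" for t i x y
    using \<psi>\<phi>[OF that(1,2)] that(3) by simp
  have lin: "lin_map sc sc' (ob (val X t) i) (ob (val Y t) i) (\<phi> t i)" if "0 \<le> t" for t i
    by (rule ch_mapD(1)[OF pmorphismD(1)[OF \<phi> that]])
  have "pmorphism sc' sc Y X \<psi>"
    unfolding pmorphism_def ch_map_def lin_map_def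
  proof (intro conjI allI impI ballI)
    fix t i x y assume *: "0 \<le> t" "x \<in> ob (val Y t) i" "y \<in> ob (val Y t) i"
    show "\<psi> t i (x + y) = \<psi> t i x + \<psi> t i y"
      using * \<psi>_in by (intro eqI subspace_add sub) (simp_all add: lin_mapD(2)[OF lin] \<phi>\<psi>)
  next
    fix t i c x assume *: "0 \<le> t" "x \<in> ob (val Y t) i"
    show "\<psi> t i (sc' c x) = sc c (\<psi> t i x)"
      using * \<psi>_in by (intro eqI subspace_scale sub) (simp_all add: lin_mapD(3)[OF lin] \<phi>\<psi>)
  next
    fix t i x assume *: "0 \<le> t" "x \<in> ob (val Y t) (Suc i)"
    show "\<psi> t i (bd (val Y t) (Suc i) x) = bd (val X t) (Suc i) (\<psi> t (Suc i) x)"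
      using * \<psi>_in by (intro eqI bd) (simp_all add: ch_mapD(2)[OF pmorphismD(1)[OF \<phi>]] \<phi>\<psi>)
  next
    fix s t i x assume *: "0 \<le> s" "s \<le> t" "x \<in> ob (val Y s) i"
    show "\<psi> t i (tr Y s t i x) = tr X s t i (\<psi> s i x)"
      using * \<psi>_in by (intro eqI tr) (simp_all add: pmorphismD(2)[OF \<phi>] \<phi>\<psi>)
  qed (rule \<psi>_in)
  then show ?thesis unfolding pisomorphic_def using \<phi> \<phi>\<psi> \<psi>\<phi> by blast
qed

lemma interleaving_transfer:
  assumes "pisomorphic a a' X X'" "pisomorphic b b' Y Y'" and I: "interleaving a b \<epsilon> X Y \<phi> \<psi>" and \<epsilon>: "0 \<le> \<epsilon>"
  shows "\<exists>\<phi> \<psi>. interleaving a' b' \<epsilon> X' Y' \<phi> \<psi>"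
proof -
  obtain \<alpha> \<alpha>' where \<alpha>: "pmorphism a a' X X' \<alpha>" "pmorphism a' a X' X \<alpha>'"
    "\<And>t i x. 0 \<le> t \<Longrightarrow> x \<in> ob (val X t) i \<Longrightarrow> \<alpha>' t i (\<alpha> t i x) = x"
    "\<And>t i y. 0 \<le> t \<Longrightarrow> y \<in> ob (val X' t) i \<Longrightarrow> \<alpha> t i (\<alpha>' t i y) = y"
    using assms(1) unfolding pisomorphic_def by blast
  obtain \<beta> \<beta>' where \<beta>: "pmorphism b b' Y Y' \<beta>" "pmorphism b' b Y' Y \<beta>'"
    "\<And>t i x. 0 \<le> t \<Longrightarrow> x \<in> ob (val Y t) i \<Longrightarrow> \<beta>' t i (\<beta> t i x) = x"
    "\<And>t i y. 0 \<le> t \<Longrightarrow> y \<in> ob (val Y' t) i \<Longrightarrow> \<beta> t i (\<beta>' t i y) = y"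
    using assms(2) unfolding pisomorphic_def by blast
  have \<phi>: "pmorphism a b X (shift_pcplx \<epsilon> Y) \<phi>" and \<psi>: "pmorphism b a Y (shift_pcplx \<epsilon> X) \<psi>"
    and \<psi>\<phi>: "\<And>t i x. 0 \<le> t \<Longrightarrow> x \<in> ob (val X t) i \<Longrightarrow> \<psi> (t + \<epsilon>) i (\<phi> t i x) = tr X t (t + 2 * \<epsilon>) i x"
    and \<phi>\<psi>: "\<And>t i x. 0 \<le> t \<Longrightarrow> x \<in> ob (val Y t) i \<Longrightarrow> \<phi> (t + \<epsilon>) i (\<psi> t i x) = tr Y t (t + 2 * \<epsilon>) i x"
    using I unfolding interleaving_def by blast+
  have two: "t + \<epsilon> + \<epsilon> = t + 2 * \<epsilon>" for t by simp
  have \<phi>_in: "\<phi> t i x \<in> ob (val Y (t + \<epsilon>)) i" if "0 \<le> t" "x \<in> ob (val X t) i" for t i x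
    using pmorphism_in[OF \<phi> that] by simp
  have \<psi>_in: "\<psi> t i x \<in> ob (val X (t + \<epsilon>)) i" if "0 \<le> t" "x \<in> ob (val Y t) i" for t i x
    using pmorphism_in[OF \<psi> that] by simp
  let ?\<phi> = "\<lambda>t i x. \<beta> (t + \<epsilon>) i (\<phi> t i (\<alpha>' t i x))" and ?\<psi> = "\<lambda>t i x. \<alpha> (t + \<epsilon>) i (\<psi> t i (\<beta>' t i x))"
  have "?\<psi> (t + \<epsilon>) i (?\<phi> t i x) = tr X' t (t + 2 * \<epsilon>) i x" if t: "0 \<le> t" and x: "x \<in> ob (val X' t) i" for t i x
  proof -
    have x': "\<alpha>' t i x \<in> ob (val X t) i" by (rule pmorphism_in[OF \<alpha>(2) t x])
    then have "?\<psi> (t + \<epsilon>) i (?\<phi> t i x) = \<alpha> (t + 2 * \<epsilon>) i (tr X t (t + 2 * \<epsilon>) i (\<alpha>' t i x))"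
      using \<beta>(3)[OF _ \<phi>_in[OF t x']] t \<epsilon> \<psi>\<phi>[OF t x'] by (simp add: two)
    also have "\<dots> = tr X' t (t + 2 * \<epsilon>) i (\<alpha> t i (\<alpha>' t i x))"
      using pmorphismD(2)[OF \<alpha>(1) t _ x', of "t + 2 * \<epsilon>"] \<epsilon> by simp
    finally show ?thesis using \<alpha>(4)[OF t x] by simp
  qed
  moreover have "?\<phi> (t + \<epsilon>) i (?\<psi> t i x) = tr Y' t (t + 2 * \<epsilon>) i x" if t: "0 \<le> t" and x: "x \<in> ob (val Y' t) i" for t i x
  proof -
    have x': "\<beta>' t i x \<in> ob (val Y t) i" by (rule pmorphism_in[OF \<beta>(2) t x])
    then have "?\<phi> (t + \<epsilon>) i (?\<psi> t i x) = \<beta> (t + 2 * \<epsilon>) i (tr Y t (t + 2 * \<epsilon>) i (\<beta>' t i x))"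
      using \<alpha>(3)[OF _ \<psi>_in[OF t x']] t \<epsilon> \<phi>\<psi>[OF t x'] by (simp add: two)
    also have "\<dots> = tr Y' t (t + 2 * \<epsilon>) i (\<beta> t i (\<beta>' t i x))"
      using pmorphismD(2)[OF \<beta>(1) t _ x', of "t + 2 * \<epsilon>"] \<epsilon> by simp
    finally show ?thesis using \<beta>(4)[OF t x] by simp
  qed
  moreover have "pmorphism a' b' X' (shift_pcplx \<epsilon> Y') ?\<phi>"
    by (rule pmorphism_compose[OF pmorphism_compose[OF \<alpha>(2) \<phi>] pmorphism_shift[OF \<beta>(1) \<epsilon>]])
  moreover have "pmorphism b' a' Y' (shift_pcplx \<epsilon> X') ?\<psi>"
    by (rule pmorphism_compose[OF pmorphism_compose[OF \<beta>(2) \<psi>] pmorphism_shift[OF \<alpha>(1) \<epsilon>]])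
  ultimately have "interleaving a' b' \<epsilon> X' Y' ?\<phi> ?\<psi>" unfolding interleaving_def by blast
  then show ?thesis by blast
qed

context interval_family
begin

lemma bd_isum_in:
  assumes "h \<in> ob (val isum r) (Suc i)"
  shows "bd (val isum r) (Suc i) h \<in> ob (val isum r) i"
proof -
  have "finite {j. h j \<noteq> 0}" using assms by (simp add: ob_isum)
  then have "finite {j. (if deg j = Suc i \<and> alive j r i then h j else 0) \<noteq> 0}"
    by (rule rev_finite_subset) auto
  then show ?thesis unfolding bd_isum[OF assms] using isum_supp[OF assms]
    by (auto simp: ob_isum split: if_splits)
qed

lemma tr_isum_refl: "h \<in> ob (val isum r) i \<Longrightarrow> tr isum r r i h = h"
  using isum_supp[of h r i] by (auto simp: tr_isum fun_eq_iff)

end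

text \<open>A perfect matching of equal intervals has cost 0, and a 0-interleaving is an
  isomorphism.\<close>

lemma (in two_interval_families) isum_pisomorphic:
  assumes R: "R \<subseteq> A \<times> A'" "A \<subseteq> Domain R" "A' \<subseteq> Range R"
    and eq: "\<And>a b. (a, b) \<in> R \<Longrightarrow> deg a = deg' b \<and> itv a = itv' b"
    and un: "\<And>a b b'. (a, b) \<in> R \<Longrightarrow> (a, b') \<in> R \<Longrightarrow> b = b'"
      "\<And>a a' b. (a, b) \<in> R \<Longrightarrow> (a', b) \<in> R \<Longrightarrow> a = a'"
  shows "pisomorphic (pointwise_scale (*)) (pointwise_scale (*)) (X.isum :: ('i \<Rightarrow> 'f::field) pcplx) Y.isum"
proof -
  have "close_matching 0 R"
    using R eq un unfolding close_matching_def by (auto simp: pair_cost_def abs_diff_def)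
  then obtain \<phi> \<psi> where I: "interleaving (pointwise_scale (*)) (pointwise_scale (*)) 0
      (X.isum :: ('i \<Rightarrow> 'f::field) pcplx) Y.isum \<phi> \<psi>"
    using matching_interleaving[of 0 R] by blast
  show ?thesis
    unfolding pisomorphic_def using I unfolding interleaving_def
    by (intro exI[of _ \<phi>] exI[of _ \<psi>]) (simp add: X.tr_isum_refl Y.tr_isum_refl shift_0)
qed

section \<open>The isometry\<close>

definition indices :: "(nat \<Rightarrow> tagged_interval multiset) \<Rightarrow> (nat \<times> tagged_interval \<times> nat) set" where
  "indices B = (SIGMA n:UNIV. mset_rep (B n))"

locale barcode =
  fixes B :: "nat \<Rightarrow> tagged_interval multiset"
  assumes tagged: "J \<in># B n \<Longrightarrow> is_tagged_interval J \<and> (n = 0 \<longrightarrow> fst J = 0)"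

lemma mset_repD: "a \<in> mset_rep A \<Longrightarrow> fst a \<in># A"
  by (auto simp: mset_rep_def intro: count_inI)

sublocale barcode \<subseteq> interval_family "indices B" fst "\<lambda>j. fst (snd j)"
proof
  fix j assume j: "j \<in> indices B"
  then have "fst (snd j) \<in># B (fst j)" using mset_repD by (auto simp: indices_def)
  from tagged[OF this] show "0 < snd (fst (snd j))" "fst (fst (snd j)) \<le> snd (fst (snd j))"
    "fst j = 0 \<Longrightarrow> fst (fst (snd j)) = 0"
    by (auto simp: is_tagged_interval_def)
qed

lemma is_tagged_barcode_iff:
  fixes sc :: "'f::field \<Rightarrow> 'a::ab_group_add \<Rightarrow> 'a"
  shows "is_tagged_barcode sc X B \<longleftrightarrow> barcode B \<and>
    pisomorphic sc (pointwise_scale (*)) X (interval_family.isum (indices B) fst (\<lambda>j. fst (snd j)))"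
proof -
  have "(\<forall>n. \<forall>J\<in>#B n. is_tagged_interval J \<and> (n = 0 \<longrightarrow> fst J = 0)) \<longleftrightarrow> barcode B"
    unfolding barcode_def by blast
  moreover have "direct_sum (SIGMA n:UNIV. mset_rep (B n)) (\<lambda>(n, J, k). interval_functor n J) =
      (interval_family.isum (indices B) fst (\<lambda>j. fst (snd j)) :: (nat \<times> tagged_interval \<times> nat \<Rightarrow> 'f) pcplx)"
    if "barcode B"
  proof -
    interpret barcode B by (rule that)
    show ?thesis unfolding isum_def unfolding indices_def case_prod_beta by (rule refl)
  qed
  ultimately show ?thesis unfolding is_tagged_barcode_def by (simp only: cong: conj_cong)
qed

section \<open>Representations of multisets and costs of matchings\<close>

lemma finite_mset_rep [simp]: "finite (mset_rep A)"
proof -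
  have "mset_rep A \<subseteq> (SIGMA x:set_mset A. {..<count A x})"
    by (auto simp: mset_rep_def intro: count_inI)
  then show ?thesis by (rule finite_subset) auto
qed

lemma mset_rep_add: "mset_rep (add_mset x A) = insert (x, count A x) (mset_rep A)"
  by (auto simp: mset_rep_def less_Suc_eq split: if_splits)

text \<open>Elements of \<open>S\<close> with the same value of \<open>f\<close> are numbered
  consecutively, each new one taking the current multiplicity as its copy number. This turns a sum
  over a basis into a sum over a multiset of intervals.\<close>

lemma mset_rep_image_bij:
  assumes "finite S"
  shows "\<exists>b. bij_betw b S (mset_rep (image_mset f (mset_set S))) \<and> (\<forall>x\<in>S. fst (b x) = f x)"
  using assms
proof (induction S rule: finite_induct)
  case empty
  then show ?case by (auto simp: mset_rep_def bij_betw_def)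
next
  case (insert x S)
  let ?A = "image_mset f (mset_set S)"
  obtain b where b: "bij_betw b S (mset_rep ?A)" "\<forall>x\<in>S. fst (b x) = f x" using insert.IH by blast
  let ?b = "b(x := (f x, count ?A (f x)))"
  have "bij_betw ?b S (mset_rep ?A)"
    using b(1) insert.hyps bij_betw_cong[of S ?b b] by fastforce
  moreover have "(f x, count ?A (f x)) \<notin> mset_rep ?A" by (simp add: mset_rep_def)
  ultimately have "bij_betw ?b (insert x S) (insert (f x, count ?A (f x)) (mset_rep ?A))"
    using insert.hyps notIn_Un_bij_betw[of x S ?b "mset_rep ?A"] by simp
  then have "bij_betw ?b (insert x S) (mset_rep (image_mset f (mset_set (insert x S))))"
    using insert.hyps by (simp add: mset_rep_add)
  moreover have "\<forall>y\<in>insert x S. fst (?b y) = f y" using b(2) by simp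
  ultimately show ?case by blast
qed

lemma matching_cost_le_iff:
  assumes "0 \<le> \<epsilon>"
  shows "matching_cost A B M \<le> ennreal \<epsilon> \<longleftrightarrow>
    (\<forall>(a, b)\<in>M. pair_cost (fst a) (fst b) \<le> ennreal \<epsilon>) \<and>
    (\<forall>a\<in>mset_rep A - Domain M. snd (fst a) \<le> ennreal (2 * \<epsilon>)) \<and>
    (\<forall>b\<in>mset_rep B - Range M. snd (fst b) \<le> ennreal (2 * \<epsilon>))"
proof -
  have "unmatched_cost J \<le> ennreal \<epsilon> \<longleftrightarrow> snd J \<le> ennreal (2 * \<epsilon>)" for J
  proof (cases "snd J")
    case (real t)
    have "snd J / 2 = ennreal (t / 2)" using real divide_ennreal[of t 2] by simp
    then show ?thesis using real assms by (simp add: unmatched_cost_def mult.commute)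
  qed (simp add: unmatched_cost_def ennreal_top_divide top_unique)
  then show ?thesis by (auto simp: matching_cost_def SUP_le_iff split: prod.splits)
qed

text \<open>Interleavings are moved to the interval sums, where one morphism handles all degrees,
  while matchings are given degree by degree. Arbitrary barcodes are allowed because uniqueness is
  deduced from this equivalence.\<close>

lemma barcode_isometry:
  fixes scX :: "'f::field \<Rightarrow> 'a::ab_group_add \<Rightarrow> 'a" and scY :: "'f \<Rightarrow> 'b::ab_group_add \<Rightarrow> 'b"
  assumes X: "is_tagged_barcode scX X B" and Y: "is_tagged_barcode scY Y B'" and \<epsilon>: "\<epsilon> > 0"
  shows "(\<exists>\<phi> \<psi>. interleaving scX scY \<epsilon> X Y \<phi> \<psi>) \<longleftrightarrow>
    (\<forall>n. \<exists>M. is_matching (B n) (B' n) M \<and> matching_cost (B n) (B' n) M \<le> ennreal \<epsilon>)"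
proof
  interpret X: barcode B using X by (simp add: is_tagged_barcode_iff)
  interpret Y: barcode B' using Y by (simp add: is_tagged_barcode_iff)
  interpret two_interval_families "indices B" fst "\<lambda>j. fst (snd j)" "indices B'" fst "\<lambda>j. fst (snd j)"
    by unfold_locales
  have X_iso: "pisomorphic scX (pointwise_scale (*)) X X.isum"
    and Y_iso: "pisomorphic scY (pointwise_scale (*)) Y Y.isum"
    using X Y by (simp_all add: is_tagged_barcode_iff)
  {
    assume "\<exists>\<phi> \<psi>. interleaving scX scY \<epsilon> X Y \<phi> \<psi>"
    then obtain \<phi>' \<psi>' where "interleaving scX scY \<epsilon> X Y \<phi>' \<psi>'" by blast
    from interleaving_transfer[OF X_iso Y_iso this less_imp_le[OF \<epsilon>]]
    obtain \<phi> \<psi> where I: "interleaving (pointwise_scale (*)) (pointwise_scale (*)) \<epsilon>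
        (X.isum :: (_ \<Rightarrow> 'f) pcplx) Y.isum \<phi> \<psi>"
      by blast
    show "\<forall>n. \<exists>M. is_matching (B n) (B' n) M \<and> matching_cost (B n) (B' n) M \<le> ennreal \<epsilon>"
    proof
      fix n
      have S: "{i \<in> indices B. fst i = n} = Pair n ` mset_rep (B n)" for B
        by (auto simp: indices_def)
      have fin: "finite {i \<in> indices B. fst i = n}" "finite {i \<in> indices B'. fst i = n}"
        unfolding S by simp_all
      obtain R where R: "R \<subseteq> {i \<in> indices B. fst i = n} \<times> {k \<in> indices B'. fst k = n}"
        "\<forall>(a, b)\<in>R. pair_cost (fst (snd a)) (fst (snd b)) \<le> ennreal \<epsilon>"
        "\<forall>a\<in>{i \<in> indices B. fst i = n} - Domain R. snd (fst (snd a)) \<le> ennreal (2 * \<epsilon>)"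
        "\<forall>b\<in>{k \<in> indices B'. fst k = n} - Range R. snd (fst (snd b)) \<le> ennreal (2 * \<epsilon>)"
        "\<forall>a b b'. (a, b) \<in> R \<longrightarrow> (a, b') \<in> R \<longrightarrow> b = b'"
        "\<forall>a a' b. (a, b) \<in> R \<longrightarrow> (a', b) \<in> R \<longrightarrow> a = a'"
        using interleaving_matching[OF I \<epsilon> fin] by blast
      \<comment> \<open>Indices of degree n carry n as first component; stripping it gives a
        matching of the multiset representations.\<close>
      define M where "M = {(a, b). ((n, a), (n, b)) \<in> R}"
      have R_M: "(a, b) \<in> M \<longleftrightarrow> ((n, a), (n, b)) \<in> R" for a b by (simp add: M_def)
      have R': "fst p = n \<and> fst q = n" if "(p, q) \<in> R" for p q using R(1) that by auto
      have "M \<subseteq> mset_rep (B n) \<times> mset_rep (B' n)" using R(1) unfolding M_def S by auto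
      moreover have "b = b'" if "(a, b) \<in> M" "(a, b') \<in> M" for a b b'
        using R(5) that unfolding R_M by blast
      moreover have "a = a'" if "(a, b) \<in> M" "(a', b) \<in> M" for a a' b
        using R(6) that unfolding R_M by blast
      ultimately have "is_matching (B n) (B' n) M" unfolding is_matching_def by blast
      moreover have "matching_cost (B n) (B' n) M \<le> ennreal \<epsilon>"
        unfolding matching_cost_le_iff[OF less_imp_le[OF \<epsilon>]]
      proof (intro conjI ballI)
        show "case p of (a, b) \<Rightarrow> pair_cost (fst a) (fst b) \<le> ennreal \<epsilon>" if "p \<in> M" for p
        proof (cases p rule: prod.exhaust)
          case (Pair a b)
          then show ?thesis using bspec[OF R(2), of "((n, a), (n, b))"] that by (simp add: R_M)
        qed
      next
        fix a assume "a \<in> mset_rep (B n) - Domain M"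
        moreover have "(n, a) \<notin> Domain R" if "a \<notin> Domain M"
        proof
          assume "(n, a) \<in> Domain R"
          then obtain q where "((n, a), q) \<in> R" by blast
          then have "(a, snd q) \<in> M" unfolding R_M using R'[of "(n, a)" q] by (cases q) simp
          with that show False by blast
        qed
        ultimately have "(n, a) \<in> {i \<in> indices B. fst i = n} - Domain R" unfolding S by blast
        from bspec[OF R(3) this] show "snd (fst a) \<le> ennreal (2 * \<epsilon>)" by simp
      next
        fix a assume "a \<in> mset_rep (B' n) - Range M"
        moreover have "(n, a) \<notin> Range R" if "a \<notin> Range M"
        proof
          assume "(n, a) \<in> Range R"
          then obtain q where "(q, (n, a)) \<in> R" by blast
          then have "(snd q, a) \<in> M" unfolding R_M using R'[of q "(n, a)"] by (cases q) simp
          with that show False by blast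
        qed
        ultimately have "(n, a) \<in> {i \<in> indices B'. fst i = n} - Range R" unfolding S by blast
        from bspec[OF R(4) this] show "snd (fst a) \<le> ennreal (2 * \<epsilon>)" by simp
      qed
      ultimately show "\<exists>M. is_matching (B n) (B' n) M \<and> matching_cost (B n) (B' n) M \<le> ennreal \<epsilon>"
        by blast
    qed
  next
    assume "\<forall>n. \<exists>M. is_matching (B n) (B' n) M \<and> matching_cost (B n) (B' n) M \<le> ennreal \<epsilon>"
    then obtain M where M: "\<And>n. is_matching (B n) (B' n) (M n)"
      and cost: "\<And>n. matching_cost (B n) (B' n) (M n) \<le> ennreal \<epsilon>" by metis
    define R where "R = {((n, a), (n, b)) | n a b. (a, b) \<in> M n}"
    have R_M: "(p, q) \<in> R \<longleftrightarrow> fst p = fst q \<and> (snd p, snd q) \<in> M (fst p)" for p q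
      by (cases p; cases q) (auto simp: R_def)
    have sub: "M n \<subseteq> mset_rep (B n) \<times> mset_rep (B' n)" for n using M[of n] by (simp add: is_matching_def)
    have "close_matching \<epsilon> R"
      unfolding close_matching_def
    proof (intro conjI ballI allI impI)
      show "R \<subseteq> indices B \<times> indices B'" using sub by (auto simp: R_def indices_def)
      show "case p of (a, b) \<Rightarrow> fst a = fst b \<and> pair_cost (fst (snd a)) (fst (snd b)) \<le> ennreal \<epsilon>"
        if "p \<in> R" for p
        using that cost unfolding matching_cost_le_iff[OF less_imp_le[OF \<epsilon>]] R_def by fastforce
    next
      fix a assume a: "a \<in> indices B - Domain R"
      then have "snd a \<in> mset_rep (B (fst a)) - Domain (M (fst a))"
        by (auto simp: indices_def R_M Domain_iff)
      then show "snd (fst (snd a)) \<le> ennreal (2 * \<epsilon>)"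
        using cost unfolding matching_cost_le_iff[OF less_imp_le[OF \<epsilon>]] by blast
    next
      fix a assume a: "a \<in> indices B' - Range R"
      then have "snd a \<in> mset_rep (B' (fst a)) - Range (M (fst a))"
        by (auto simp: indices_def R_M Range_iff)
      then show "snd (fst (snd a)) \<le> ennreal (2 * \<epsilon>)"
        using cost unfolding matching_cost_le_iff[OF less_imp_le[OF \<epsilon>]] by blast
    next
      fix a b b' assume "(a, b) \<in> R" "(a, b') \<in> R"
      then show "b = b'" using M[of "fst a"] unfolding R_M is_matching_def by (metis prod.expand)
    next
      fix a a' b assume "(a, b) \<in> R" "(a', b) \<in> R"
      then show "a = a'" using M[of "fst a"] unfolding R_M is_matching_def by (metis prod.expand)
    qed
    from matching_interleaving[OF this less_imp_le[OF \<epsilon>]]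
    obtain \<phi> \<psi> where "interleaving (pointwise_scale (*)) (pointwise_scale (*)) \<epsilon>
        (X.isum :: (_ \<Rightarrow> 'f) pcplx) Y.isum \<phi> \<psi>" by blast
    from interleaving_transfer[OF pisomorphic_sym[OF X_iso] pisomorphic_sym[OF Y_iso] this less_imp_le[OF \<epsilon>]]
    show "\<exists>\<phi> \<psi>. interleaving scX scY \<epsilon> X Y \<phi> \<psi>" .
  }
qed

text \<open>An interval of degree n gives a generator alive at time 0, as endpoints are positive, so
  the complex at time 0 is nonzero in degree n.\<close>

lemma finite_nonempty_barcode:
  fixes sc :: "'f::field \<Rightarrow> 'a::ab_group_add \<Rightarrow> 'a"
  assumes X: "is_tagged_barcode sc X B" and fin: "finite {i. ob (val X 0) i \<noteq> {0}}"
    and m: "module sc" and sub: "\<And>i. module.subspace sc (ob (val X 0) i)"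
  shows "finite {n. B n \<noteq> {#}}"
proof -
  interpret barcode B using X by (simp add: is_tagged_barcode_iff)
  obtain \<phi> \<psi> where \<phi>: "pmorphism sc (pointwise_scale (*)) X isum \<phi>"
    and \<psi>: "pmorphism (pointwise_scale (*)) sc isum X \<psi>"
    and \<phi>\<psi>: "\<And>t i y. 0 \<le> t \<Longrightarrow> y \<in> ob (val isum t) i \<Longrightarrow> \<phi> t i (\<psi> t i y) = y"
    using X unfolding is_tagged_barcode_iff pisomorphic_def by blast
  have "ob (val X 0) n \<noteq> {0}" if nonempty: "B n \<noteq> {#}" for n
  proof
    assume zero: "ob (val X 0) n = {0}"
    obtain J where "J \<in># B n" using nonempty by blast
    then have j: "(n, J, 0) \<in> indices B" by (simp add: indices_def mset_rep_def)
    let ?g = "gen (n, J, 0) :: _ \<Rightarrow> 'f"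
    have g: "?g \<in> ob (val isum 0) n" using alive_0[OF j] by (simp add: gen_in_isum[OF j])
    have "\<psi> 0 n ?g = 0" using pmorphism_in[OF \<psi> order_refl g] zero by simp
    then have "?g = \<phi> 0 n 0" using \<phi>\<psi>[OF order_refl g] by simp
    also have "\<dots> = 0"
      by (rule lin_map_zero[OF m module_pointwise_scale ch_mapD(1)[OF pmorphismD(1)[OF \<phi> order_refl]] sub])
    finally have "?g (n, J, 0) = 0" by simp
    then show False by (simp add: gen_def)
  qed
  then have "{n. B n \<noteq> {#}} \<subseteq> {i. ob (val X 0) i \<noteq> {0}}" by blast
  then show ?thesis using fin finite_subset by blast
qed

section \<open>Uniqueness of the barcode\<close>

lemma interleaving_self:
  assumes "parametrized_complex sc X" "0 \<le> \<epsilon>"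
  shows "interleaving sc sc \<epsilon> X X (\<lambda>t. tr X t (t + \<epsilon>)) (\<lambda>t. tr X t (t + \<epsilon>))"
proof -
  have "pmorphism sc sc X (shift_pcplx \<epsilon> X) (\<lambda>t. tr X t (t + \<epsilon>))"
    using assms unfolding pmorphism_def parametrized_complex_def by simp
  moreover have "tr X (t + \<epsilon>) (t + \<epsilon> + \<epsilon>) i (tr X t (t + \<epsilon>) i x) = tr X t (t + 2 * \<epsilon>) i x"
    if "0 \<le> t" "x \<in> ob (val X t) i" for t i x
  proof -
    have "t + \<epsilon> + \<epsilon> = t + 2 * \<epsilon>" by simp
    then show ?thesis
      using assms that unfolding parametrized_complex_def by (metis add_increasing2 le_add_same_cancel1)
  qed
  ultimately show ?thesis unfolding interleaving_def by blast
qed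

lemma count_le_of_matching:
  assumes "M \<subseteq> mset_rep A \<times> mset_rep B" "mset_rep A \<subseteq> Domain M"
    and eq: "\<And>a b. (a, b) \<in> M \<Longrightarrow> fst a = fst b"
    and inj: "\<And>a a' b. (a, b) \<in> M \<Longrightarrow> (a', b) \<in> M \<Longrightarrow> a = a'"
  shows "count A x \<le> count B x"
proof -
  define g where "g a = (SOME b. (a, b) \<in> M)" for a
  have g: "(a, g a) \<in> M" if "a \<in> mset_rep A" for a
    using that assms(2) unfolding g_def by (metis Domain.cases someI subsetD)
  have fibre: "Pair x ` {..<count C x} = {a \<in> mset_rep C. fst a = x}" for C
    by (auto simp: mset_rep_def)
  have card: "card {a \<in> mset_rep C. fst a = x} = count C x" for C
    unfolding fibre[symmetric] by (subst card_image) (auto simp: inj_on_def)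
  have "inj_on g {a \<in> mset_rep A. fst a = x}"
    using g inj by (intro inj_onI) (metis (mono_tags, lifting) mem_Collect_eq)
  moreover have "g ` {a \<in> mset_rep A. fst a = x} \<subseteq> {a \<in> mset_rep B. fst a = x}"
    using g eq assms(1) by fastforce
  ultimately have "card {a \<in> mset_rep A. fst a = x} \<le> card {a \<in> mset_rep B. fst a = x}"
    by (rule card_inj_on_le) simp
  then show ?thesis by (simp add: card)
qed

text \<open>The internal maps interleave \<open>X\<close> with itself for every \<epsilon> > 0, so
  matchings of arbitrarily small cost exist. There are only finitely many matchings, so one has cost
  0; it pairs equal intervals and leaves nothing unmatched, since endpoints are positive.\<close>

lemma tagged_barcode_unique:
  assumes X: "parametrized_complex sc X" and B: "is_tagged_barcode sc X B" and B': "is_tagged_barcode sc X B'"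
  shows "B = B'"
proof
  fix n
  let ?\<M> = "{M. is_matching (B n) (B' n) M}" and ?c = "matching_cost (B n) (B' n)"
  have small: "\<exists>M. is_matching (B n) (B' n) M \<and> ?c M \<le> ennreal \<epsilon>" if "\<epsilon> > 0" for \<epsilon>
    using barcode_isometry[OF B B' that] interleaving_self[OF X less_imp_le[OF that]] by blast
  have "?\<M> \<subseteq> Pow (mset_rep (B n) \<times> mset_rep (B' n))" by (auto simp: is_matching_def)
  then have fin: "finite (?c ` ?\<M>)" by (meson finite_Pow_iff finite_SigmaI finite_imageI finite_mset_rep finite_subset)
  have ne: "?c ` ?\<M> \<noteq> {}" using small[of 1] by auto
  obtain M where M: "is_matching (B n) (B' n) M" and Mmin: "?c M = Min (?c ` ?\<M>)"
    using Min_in[OF fin ne] by auto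
  have "?c M \<le> ennreal \<epsilon>" if "\<epsilon> > 0" for \<epsilon>
    using small[OF that] Min_le[OF fin] unfolding Mmin by (blast intro: order_trans)
  then have "?c M \<le> 0" using ennreal_le_epsilon[of 0 "?c M"] by simp
  then have "?c M \<le> ennreal 0" by simp
  then have c: "\<forall>(a, b)\<in>M. pair_cost (fst a) (fst b) \<le> ennreal 0"
    "\<forall>a\<in>mset_rep (B n) - Domain M. snd (fst a) \<le> ennreal (2 * 0)"
    "\<forall>b\<in>mset_rep (B' n) - Range M. snd (fst b) \<le> ennreal (2 * 0)"
    unfolding matching_cost_le_iff[OF order_refl] by blast+
  have pos: "0 < snd (fst a)" if "is_tagged_barcode sc X C" "a \<in> mset_rep (C n)" for C a
    using that(1) mset_repD[OF that(2)] unfolding is_tagged_barcode_def is_tagged_interval_def by blast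
  have eq: "fst a = fst b" if "(a, b) \<in> M" for a b
  proof -
    have "pair_cost (fst a) (fst b) \<le> ennreal 0" using c(1) that by blast
    then show ?thesis
      unfolding pair_cost_def max.bounded_iff abs_diff_le_iff by (simp add: prod_eq_iff antisym)
  qed
  have sub: "M \<subseteq> mset_rep (B n) \<times> mset_rep (B' n)"
    and inj: "\<And>a b b'. (a, b) \<in> M \<Longrightarrow> (a, b') \<in> M \<Longrightarrow> b = b'" "\<And>a a' b. (a, b) \<in> M \<Longrightarrow> (a', b) \<in> M \<Longrightarrow> a = a'"
    using M unfolding is_matching_def by blast+
  have "snd (fst a) \<le> ennreal (2 * 0) \<longleftrightarrow> \<not> 0 < snd (fst a)" for a :: "tagged_interval \<times> nat"
    by simp
  then have dom: "mset_rep (B n) \<subseteq> Domain M" "mset_rep (B' n) \<subseteq> Range M"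
    using c(2,3) pos[OF B] pos[OF B'] by blast+
  show "B n = B' n"
  proof (rule multiset_eqI)
    fix x
    show "count (B n) x = count (B' n) x"
    proof (rule antisym)
      show "count (B n) x \<le> count (B' n) x" using count_le_of_matching[OF sub dom(1) eq inj(2)] .
      show "count (B' n) x \<le> count (B n) x"
        by (rule count_le_of_matching[of "M\<inverse>"]) (use sub dom eq inj in auto)
    qed
  qed
qed

lemma (in factored) tagged_barcode_exists: "\<exists>B. is_tagged_barcode sc X B"
proof -
  obtain Y where Y: "\<And>i. adapted i (Y (Suc i)) (Y i)" using adapted_family by blast
  interpret adapted_factored sc X Y by unfold_locales (rule Y)
  \<comment> \<open>Distinct basis elements may yield the same interval; the multiset keeps one copy
    for each.\<close>
  define B where "B n = image_mset (\<lambda>y. itv (n, y)) (mset_set (Y n))" for n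
  interpret barcode B
  proof
    fix J n assume "J \<in># B n"
    then obtain y where "y \<in> Y n" "J = itv (n, y)" using Y_finite by (auto simp: B_def)
    then show "is_tagged_interval J \<and> (n = 0 \<longrightarrow> fst J = 0)"
      using F.pos[of "(n, y)"] F.tag_le[of "(n, y)"] F.tag_0[of "(n, y)"]
      by (auto simp: is_tagged_interval_def)
  qed
  interpret two_interval_families "Sigma UNIV Y" fst itv "indices B" fst "\<lambda>j. fst (snd j)"
    by unfold_locales
  have "\<exists>b. bij_betw b (Y n) (mset_rep (B n)) \<and> (\<forall>y\<in>Y n. fst (b y) = itv (n, y))" for n
    unfolding B_def by (rule mset_rep_image_bij[OF Y_finite])
  then obtain b where b: "\<And>n. bij_betw (b n) (Y n) (mset_rep (B n))" "\<And>n y. y \<in> Y n \<Longrightarrow> fst (b n y) = itv (n, y)"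
    by metis
  have "pisomorphic (pointwise_scale (*)) (pointwise_scale (*)) F.isum isum"
  proof (rule isum_pisomorphic)
    let ?R = "{((n, y), (n, b n y)) | n y. y \<in> Y n}"
    show "?R \<subseteq> Sigma UNIV Y \<times> indices B" using b(1) by (auto simp: indices_def bij_betw_def)
    show "Sigma UNIV Y \<subseteq> Domain ?R" by (auto simp: Domain_iff)
    show "indices B \<subseteq> Range ?R"
      using b(1) by (auto simp: indices_def bij_betw_def Range_iff image_iff set_eq_iff) blast
    show "fst p = fst q \<and> itv p = fst (snd q)" if "(p, q) \<in> ?R" for p q using that b(2) by auto
    show "q = q'" if "(p, q) \<in> ?R" "(p, q') \<in> ?R" for p q q' using that by auto
    show "p = p'" if "(p, q) \<in> ?R" "(p', q) \<in> ?R" for p p' q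
      using that b(1) by (auto simp: bij_betw_def inj_on_def)
  qed
  moreover have "pisomorphic (pointwise_scale (*)) sc F.isum X"
    by (rule pisomorphic_of_bij[OF synth_pmorphism module_pointwise_scale F.subspace_isum F.bd_isum_in
          F.tr_isum_in synth_bij])
  ultimately have "pisomorphic sc (pointwise_scale (*)) X isum"
    using pisomorphic_sym pisomorphic_trans by blast
  then show ?thesis using is_tagged_barcode_iff barcode_axioms by blast
qed

lemma (in factored) is_tagged_barcode_tBar: "is_tagged_barcode sc X (tBar sc X)"
proof -
  have "\<exists>!B. is_tagged_barcode sc X B"
    using tagged_barcode_exists tagged_barcode_unique factored unfolding factored_complex_def by blast
  then show ?thesis unfolding tBar_def by (rule theI')
qed

section \<open>The maximum over all degrees\<close>

lemma bottleneck_dist_empty: "bottleneck_dist {#} {#} = 0"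
proof -
  have "is_matching {#} {#} {}" by (simp add: is_matching_def)
  moreover have "matching_cost {#} {#} {} = 0" by (simp add: matching_cost_def mset_rep_def bot_ennreal)
  ultimately show ?thesis unfolding bottleneck_dist_def by (metis INF_lower le_zero_eq mem_Collect_eq)
qed

theorem theorem2p23:
  fixes scX :: "'f::field \<Rightarrow> 'a::ab_group_add \<Rightarrow> 'a"
    and scY :: "'f \<Rightarrow> 'b::ab_group_add \<Rightarrow> 'b"
    and X :: "'a pcplx" and Y :: "'b pcplx"
  assumes "vector_space scX" and "vector_space scY"
    and "factored_complex scX X" and "factored_complex scY Y"
  shows "finite (range (\<lambda>n. bottleneck_dist (tBar scX X n) (tBar scY Y n))) \<and>
    interleaving_dist scX scY X Y = (MAX n. bottleneck_dist (tBar scX X n) (tBar scY Y n))"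
proof -
  interpret X: factored scX X by (intro factored.intro scaled_space.intro factored_axioms.intro assms)
  interpret Y: factored scY Y by (intro factored.intro scaled_space.intro factored_axioms.intro assms)
  define D where "D n = bottleneck_dist (tBar scX X n) (tBar scY Y n)" for n
  note isometry = barcode_isometry[OF X.is_tagged_barcode_tBar Y.is_tagged_barcode_tBar]
  have "finite {n. tBar scX X n \<noteq> {#}}" "finite {n. tBar scY Y n \<noteq> {#}}"
    using finite_nonempty_barcode[OF X.is_tagged_barcode_tBar X.finite_degrees X.module_axioms X.subspace_ob]
      finite_nonempty_barcode[OF Y.is_tagged_barcode_tBar Y.finite_degrees Y.module_axioms Y.subspace_ob]
    by auto
  \<comment> \<open>All but finitely many degrees contribute the value 0 of two empty barcodes, so
    the maximum exists.\<close>
  moreover have "range D \<subseteq> insert 0 (D ` ({n. tBar scX X n \<noteq> {#}} \<union> {n. tBar scY Y n \<noteq> {#}}))"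
    by (auto simp: D_def bottleneck_dist_empty)
  ultimately have fin: "finite (range D)"
    by (meson finite_UnI finite_imageI finite_insert finite_subset)
  have "interleaving_dist scX scY X Y = Max (range D)"
  proof (rule antisym)
    show "interleaving_dist scX scY X Y \<le> Max (range D)"
    \<comment> \<open>A number strictly above all the infima leaves room for a matching of smaller
      cost in every degree, and it is positive, as interleavings demand.\<close>
    proof (rule dense_ge)
      fix x assume x: "Max (range D) < x"
      show "interleaving_dist scX scY X Y \<le> x"
      proof (cases x)
        case (real \<epsilon>)
        then have \<epsilon>: "\<epsilon> > 0" using x by (cases "\<epsilon> = 0") auto
        have "\<exists>M. is_matching (tBar scX X n) (tBar scY Y n) M \<and>
            matching_cost (tBar scX X n) (tBar scY Y n) M \<le> ennreal \<epsilon>" for n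
        proof -
          have "D n < ennreal \<epsilon>" using x real(2) Max_ge[OF fin, of "D n"] by auto
          then show ?thesis unfolding D_def bottleneck_dist_def INF_less_iff by (auto intro: less_imp_le)
        qed
        then show ?thesis
          unfolding interleaving_dist_def real(2) using isometry[OF \<epsilon>] \<epsilon> by (intro Inf_lower) blast
      qed simp
    qed
    show "Max (range D) \<le> interleaving_dist scX scY X Y"
      unfolding interleaving_dist_def
    proof (rule Inf_greatest, clarify)
      fix \<epsilon> :: real and \<phi> \<psi> assume \<epsilon>: "\<epsilon> > 0" and "interleaving scX scY \<epsilon> X Y \<phi> \<psi>"
      then have "\<exists>M. is_matching (tBar scX X n) (tBar scY Y n) M \<and>
          matching_cost (tBar scX X n) (tBar scY Y n) M \<le> ennreal \<epsilon>" for n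
        using isometry[OF \<epsilon>] by blast
      then have "D n \<le> ennreal \<epsilon>" for n
        unfolding D_def bottleneck_dist_def by (meson INF_lower2 mem_Collect_eq)
      then show "Max (range D) \<le> ennreal \<epsilon>" using fin by (subst Max_le_iff) auto
    qed
  qed
  then show ?thesis using fin unfolding D_def by blast
qed

end
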